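(* Let $(W,S)$ be a Coxeter system of arbitrary type with a weight function $\varphi:W\to\mathbb Z_{\ge0}$ satisfying $\varphi(s)>0$ for all $s\in S$, with associated weighted Hecke algebra $H$ over $\mathbb Z[\mathsf q,\mathsf q^{-1}]$. Assume that $(W,S,\varphi)$ is bounded and that Lusztig's properties P1–P15 hold, and let $\mathcal J$ be the asymptotic algebra, with basis $(\mathsf t_w)_{w\in W}$. Define a linear map $\mathsf{Tr}^\infty:\mathcal J\to\mathbb Z$ and a bilinear form $\langle\cdot,\cdot\rangle^\infty$ on $\mathcal J$ by $$\mathsf{Tr}^\infty\Big(\sum a_w\mathsf t_w\Big)=\sum_{d\in\mathcal D}n_da_d,\qquad\langle A,B\rangle^\infty=\mathsf{Tr}^\infty(AB^* ),\qquad \Big(\sum a_w\mathsf t_w\Big)^*=\sum a_w\mathsf t_{w^{-1}}.$$ Then: (1) $\mathsf{Tr}^\infty$ is a trace functional on $\mathcal J$ (that is, $\mathsf{Tr}^\infty(AB)=\mathsf{Tr}^\infty(BA)$ for all $A,B\in\mathcal J$). (2) The bilinear form $\langle\cdot,\cdot\rangle^\infty$ is an inner product (symmetric, positive definite) and $(\mathsf t_w)_{w\in W}$ is an orthonormal basis of $\mathcal J$. (3) For $A,B,C\in\mathcal J$ we have $\langle AB,C\rangle^\infty=\langle B,A^*C\rangle^\infty$.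
   Context: A weight function satisfies $\varphi(ww')=\varphi(w)+\varphi(w')$ whenever $\ell(ww')=\ell(w)+\ell(w')$. $H$ is the algebra over $\mathsf R=\mathbb Z[\mathsf q,\mathsf q^{-1}]$ with basis $(T_w)_{w\in W}$, $T_wT_{w'}=T_{ww'}$ if $\ell(ww')=\ell(w)+\ell(w')$ and $T_s^2=1+(\mathsf q^{\varphi(s)}-\mathsf q^{-\varphi(s)})T_s$ for $s\in S$. $(W,S,\varphi)$ is bounded if there is $N\ge0$ such that all structure constants $f_{x,y,z}$ in $T_xT_y=\sum_zf_{x,y,z}T_z$ satisfy $\deg f_{x,y,z}\le N$ ($\deg$ is the degree in $\mathsf q$). The bar involution is $\overline{\sum a_wT_w}=\sum\overline{a_w}T_{w^{-1}}^{-1}$, $\overline{\mathsf q}=\mathsf q^{-1}$. $(C_w)$ is the Kazhdan–Lusztig basis: $\overline{C_w}=C_w$ and $C_w=T_w+\sum_{v<w}P_{v,w}T_v$ with $P_{v,w}\in\mathsf q^{-1}\mathbb Z[\mathsf q^{-1}]$. Write $C_xC_y=\sum_zh_{x,y,z}C_z$, $\mathbf a(z)=\max_{x,y}\deg h_{x,y,z}$ (finite by P1), and let $\gamma_{x,y,z^{-1}}\in\mathbb Z$ be the coefficient of $\mathsf q^{\mathbf a(z)}$ in $h_{x,y,z}$. Let $\delta(w)=-\deg P_{e,w}$ and let $n_w$ be the coefficient of $\mathsf q^{-\delta(w)}$ in $P_{e,w}$ (with $P_{e,e}=1$), and $\mathcal D=\{w\in W:\mathbf a(w)=\delta(w)\}$.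 Preorders: $\le_L$ is the transitive closure of ($x\le_Ly$ if $h_{z,y,x}\ne0$ for some $z$), $\le_R$ of ($x\le_Ry$ if $h_{y,z,x}\ne0$ for some $z$), $\le_{LR}$ is generated by both; $\sim_L,\sim_R,\sim_{LR}$ are the equivalence relations, with classes the left, right, two-sided cells. P1–P15: P1. $\mathbf a(z)\le\delta(z)$ for all $z$. P2. If $d\in\mathcal D$ and $\gamma_{x,y,d}\ne0$ then $y=x^{-1}$. P3. For each $x$ there is a unique $d\in\mathcal D$ with $\gamma_{x,x^{-1},d}\ne0$. P4. $z'\le_{LR}z$ implies $\mathbf a(z')\ge\mathbf a(z)$. P5. If $d\in\mathcal D$ and $\gamma_{x,x^{-1},d}\ne0$ then $\gamma_{x,x^{-1},d}=n_d=\pm1$. P6. $d^{-1}=d$ for $d\in\mathcal D$. P7. $\gamma_{x,y,z}=\gamma_{y,z,x}$. P8. If $\gamma_{x,y,z}\ne0$ then $y\sim_Rx^{-1}$, $z\sim_Ry^{-1}$, $x\sim_Rz^{-1}$. P9 (resp. P10, P11). If $z'\le_Lz$ (resp. $\le_R$, $\le_{LR}$) and $\mathbf a(z')=\mathbf a(z)$ then $z'\sim_Lz$ (resp. $\sim_R$, $\sim_{LR}$). P12. For $I\subseteq S$ and $y\in W_I$, $\mathbf a(y)$ computed in $W_I$ equals $\mathbf a(y)$ computed in $W$. P13. Each right cell $\Gamma$ contains a unique $d\in\mathcal D$, and $\gamma_{x,x^{-1},d}\ne0$ for all $x\in\Gamma$. P14. $z\sim_{LR}z^{-1}$. P15. If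 $\mathsf q'$ is a second indeterminate and $h'_{x,y,z}$ is obtained from $h_{x,y,z}$ by $\mathsf q\mapsto\mathsf q'$, then for $\mathbf a(w)=\mathbf a(y)$: $\sum_{y'}h'_{w,x',y'}h_{x,y',y}=\sum_{y'}h_{x,w,y'}h'_{y',x',y}$. The asymptotic algebra $\mathcal J$ is the free $\mathbb Z$-module with basis $(\mathsf t_w)_{w\in W}$ and multiplication $\mathsf t_x\mathsf t_y=\sum_z\gamma_{x,y,z^{-1}}\mathsf t_z$, which is associative under these assumptions. *)

theory Defs
  imports
    "HOL-Algebra.Free_Abelian_Groups"
    "HOL-Algebra.Multiplicative_Group"
    "HOL-Library.Poly_Mapping"
begin

section \<open>Coxeter systems and weight functions\<close>

definition word_prod :: "('w, 'b) monoid_scheme \<Rightarrow> 'w list \<Rightarrow> 'w"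
  where "word_prod G ws = foldr (\<lambda>s x. s \<otimes>\<^bsub>G\<^esub> x) ws \<one>\<^bsub>G\<^esub>"

text \<open>
  The congruence on words in \<open>S\<close> generated by the Coxeter relations \<open>(st)\<^sup>m = 1\<close>, where \<open>m\<close> is the
  order of \<open>st\<close> in \<open>G\<close>. The order function of the library is \<open>0\<close> for elements of infinite order, so
  that such a pair contributes only the trivial relation. The case \<open>s = t\<close> gives the relation
  \<open>ss = 1\<close>; hence every letter is its own inverse, and words without formal inverses suffice to
  present the group.
\<close>

inductive coxeter_equiv :: "('w, 'b) monoid_scheme \<Rightarrow> 'w set \<Rightarrow> 'w list \<Rightarrow> 'w list \<Rightarrow> bool"
  for G S where
    refl: "us \<in> lists S \<Longrightarrow> coxeter_equiv G S us us"
  | sym: "coxeter_equiv G S us vs \<Longrightarrow> coxeter_equiv G S vs us"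
  | trans: "coxeter_equiv G S us vs \<Longrightarrow> coxeter_equiv G S vs ws \<Longrightarrow> coxeter_equiv G S us ws"
  | relator: "us \<in> lists S \<Longrightarrow> vs \<in> lists S \<Longrightarrow> s \<in> S \<Longrightarrow> t \<in> S \<Longrightarrow>
      coxeter_equiv G S (us @ concat (replicate (group.ord G (s \<otimes>\<^bsub>G\<^esub> t)) [s, t]) @ vs) (us @ vs)"

text \<open>
  \<open>S\<close> consists of involutions, generates \<open>G\<close>, and together with the Coxeter relations it presents
  \<open>G\<close>. The rank may be infinite.
\<close>

definition coxeter_system :: "('w, 'b) monoid_scheme \<Rightarrow> 'w set \<Rightarrow> bool"
  where "coxeter_system G S \<longleftrightarrow>
    group G \<and> S \<subseteq> carrier G \<and> generate G S = carrier G \<and>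
    (\<forall>s\<in>S. group.ord G s = 2) \<and>
    (\<forall>us\<in>lists S. \<forall>vs\<in>lists S. word_prod G us = word_prod G vs \<longrightarrow> coxeter_equiv G S us vs)"

definition cox_length :: "('w, 'b) monoid_scheme \<Rightarrow> 'w set \<Rightarrow> 'w \<Rightarrow> nat"
  where "cox_length G S w = (LEAST n. \<exists>ws\<in>lists S. length ws = n \<and> word_prod G ws = w)"

definition reflections :: "('w, 'b) monoid_scheme \<Rightarrow> 'w set \<Rightarrow> 'w set"
  where "reflections G S = {w \<otimes>\<^bsub>G\<^esub> s \<otimes>\<^bsub>G\<^esub> inv\<^bsub>G\<^esub> w | w s. w \<in> carrier G \<and> s \<in> S}"

definition bruhat_less :: "('w, 'b) monoid_scheme \<Rightarrow> 'w set \<Rightarrow> 'w \<Rightarrow> 'w \<Rightarrow> bool"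
  where "bruhat_less G S =
    (\<lambda>u v. u \<in> carrier G \<and> (\<exists>t\<in>reflections G S. v = u \<otimes>\<^bsub>G\<^esub> t) \<and>
           cox_length G S u < cox_length G S v)\<^sup>+\<^sup>+"

definition weight_function :: "('w, 'b) monoid_scheme \<Rightarrow> 'w set \<Rightarrow> ('w \<Rightarrow> nat) \<Rightarrow> bool"
  where "weight_function G S \<phi> \<longleftrightarrow>
    (\<forall>w\<in>carrier G. \<forall>w'\<in>carrier G.
       cox_length G S (w \<otimes>\<^bsub>G\<^esub> w') = cox_length G S w + cox_length G S w' \<longrightarrow>
       \<phi> (w \<otimes>\<^bsub>G\<^esub> w') = \<phi> w + \<phi> w')"


section \<open>Laurent polynomials with integer coefficients\<close>

text \<open>
  The ring \<open>\<int>[q, q\<^sup>-\<^sup>1]\<close> is the monoid algebra of the additive monoid of integers; the key is the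
  exponent of \<open>q\<close>.
\<close>

type_synonym laurent = "int \<Rightarrow>\<^sub>0 int"

abbreviation qpow :: "int \<Rightarrow> laurent"
  where "qpow k \<equiv> Poly_Mapping.single k 1"

text \<open>
  Meaningful for \<open>p \<noteq> 0\<close> only. The zero polynomial, of degree \<open>-\<infinity>\<close>, is excluded explicitly where
  degrees are bounded or maximised.
\<close>

definition ldeg :: "laurent \<Rightarrow> int"
  where "ldeg p = Max (Poly_Mapping.keys p)"

definition lbar :: "laurent \<Rightarrow> laurent"
  where "lbar p = Poly_Mapping.map_key uminus p"

text \<open>
  Laurent polynomials in a second variable \<open>q'\<close> with coefficients in \<open>\<int>[q, q\<^sup>-\<^sup>1]\<close>, and the two
  embeddings sending a Laurent polynomial to itself and to the result of \<open>q \<mapsto> q'\<close> respectively.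
\<close>

type_synonym laurent2 = "int \<Rightarrow>\<^sub>0 laurent"

definition in_q :: "laurent \<Rightarrow> laurent2"
  where "in_q p = Poly_Mapping.single 0 p"

definition in_q' :: "laurent \<Rightarrow> laurent2"
  where "in_q' p = Poly_Mapping.map (Poly_Mapping.single 0) p"


section \<open>The Hecke algebra\<close>

text \<open>
  The underlying module of the Hecke algebra is the free module of finitely supported functions
  on the group, with \<open>T\<^sub>w\<close> the function supported at \<open>w\<close> with value 1.
\<close>

definition hsmult :: "laurent \<Rightarrow> ('w \<Rightarrow>\<^sub>0 laurent) \<Rightarrow> ('w \<Rightarrow>\<^sub>0 laurent)"
  where "hsmult a h = Poly_Mapping.map ((*) a) h"

abbreviation T_basis :: "'w \<Rightarrow> ('w \<Rightarrow>\<^sub>0 laurent)"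
  where "T_basis w \<equiv> Poly_Mapping.single w 1"

definition hecke_algebra ::
    "('w, 'b) monoid_scheme \<Rightarrow> 'w set \<Rightarrow> ('w \<Rightarrow> nat) \<Rightarrow> ('w \<Rightarrow>\<^sub>0 laurent) ring \<Rightarrow> bool"
  where "hecke_algebra G S \<phi> H \<longleftrightarrow>
    ring H \<and>
    carrier H = {h. Poly_Mapping.keys h \<subseteq> carrier G} \<and>
    \<zero>\<^bsub>H\<^esub> = 0 \<and>
    (\<forall>g\<in>carrier H. \<forall>h\<in>carrier H. g \<oplus>\<^bsub>H\<^esub> h = g + h) \<and>
    (\<forall>a. \<forall>g\<in>carrier H. \<forall>h\<in>carrier H.
       hsmult a g \<otimes>\<^bsub>H\<^esub> h = hsmult a (g \<otimes>\<^bsub>H\<^esub> h) \<and> g \<otimes>\<^bsub>H\<^esub> hsmult a h = hsmult a (g \<otimes>\<^bsub>H\<^esub> h)) \<and>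
    (\<forall>w\<in>carrier G. \<forall>w'\<in>carrier G.
       cox_length G S (w \<otimes>\<^bsub>G\<^esub> w') = cox_length G S w + cox_length G S w' \<longrightarrow>
       T_basis w \<otimes>\<^bsub>H\<^esub> T_basis w' = T_basis (w \<otimes>\<^bsub>G\<^esub> w')) \<and>
    (\<forall>s\<in>S. T_basis s \<otimes>\<^bsub>H\<^esub> T_basis s =
       \<one>\<^bsub>H\<^esub> \<oplus>\<^bsub>H\<^esub> hsmult (qpow (int (\<phi> s)) - qpow (- int (\<phi> s))) (T_basis s))"

definition hecke_bounded :: "('w, 'b) monoid_scheme \<Rightarrow> ('w \<Rightarrow>\<^sub>0 laurent) ring \<Rightarrow> bool"
  where "hecke_bounded G H \<longleftrightarrow>
    (\<exists>N\<ge>0. \<forall>x\<in>carrier G. \<forall>y\<in>carrier G. \<forall>z\<in>carrier G.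
       let f = Poly_Mapping.lookup (T_basis x \<otimes>\<^bsub>H\<^esub> T_basis y) z in f \<noteq> 0 \<longrightarrow> ldeg f \<le> N)"

definition hecke_bar ::
    "('w, 'b) monoid_scheme \<Rightarrow> ('w \<Rightarrow>\<^sub>0 laurent) ring \<Rightarrow> ('w \<Rightarrow>\<^sub>0 laurent) \<Rightarrow> ('w \<Rightarrow>\<^sub>0 laurent)"
  where "hecke_bar G H h =
    (\<Sum>w\<in>Poly_Mapping.keys h.
       hsmult (lbar (Poly_Mapping.lookup h w)) (inv\<^bsub>H\<^esub> (T_basis (inv\<^bsub>G\<^esub> w))))"

text \<open>
  \<open>C\<close> is the Kazhdan--Lusztig basis; the polynomial \<open>P\<^sub>v\<^sub>,\<^sub>w\<close> is the coefficient of \<open>T\<^sub>v\<close> in \<open>C w\<close>.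
\<close>

definition kl_basis ::
    "('w, 'b) monoid_scheme \<Rightarrow> 'w set \<Rightarrow> ('w \<Rightarrow>\<^sub>0 laurent) ring \<Rightarrow> ('w \<Rightarrow> ('w \<Rightarrow>\<^sub>0 laurent)) \<Rightarrow> bool"
  where "kl_basis G S H C \<longleftrightarrow>
    (\<forall>w\<in>carrier G.
       C w \<in> carrier H \<and> hecke_bar G H (C w) = C w \<and>
       Poly_Mapping.lookup (C w) w = 1 \<and>
       (\<forall>v. v \<noteq> w \<and> Poly_Mapping.lookup (C w) v \<noteq> 0 \<longrightarrow>
          bruhat_less G S v w \<and> Poly_Mapping.keys (Poly_Mapping.lookup (C w) v) \<subseteq> {..<0}))"


section \<open>Lusztig's a-function, cells, and the properties P1--P15\<close>

context
  fixes G :: "('w, 'b) monoid_scheme" (structure)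
    and H :: "('w \<Rightarrow>\<^sub>0 laurent) ring"
    and C :: "'w \<Rightarrow> ('w \<Rightarrow>\<^sub>0 laurent)"
begin

text \<open>\<open>kl_prod x y\<close> is the finitely supported function \<open>z \<mapsto> h\<^sub>x\<^sub>,\<^sub>y\<^sub>,\<^sub>z\<close>, the coordinates of \<open>C x C y\<close>.\<close>

definition kl_prod :: "'w \<Rightarrow> 'w \<Rightarrow> ('w \<Rightarrow>\<^sub>0 laurent)"
  where "kl_prod x y = (THE c. Poly_Mapping.keys c \<subseteq> carrier G \<and>
     C x \<otimes>\<^bsub>H\<^esub> C y = (\<Sum>z\<in>Poly_Mapping.keys c. hsmult (Poly_Mapping.lookup c z) (C z)))"

definition hcoeff :: "'w \<Rightarrow> 'w \<Rightarrow> 'w \<Rightarrow> laurent"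
  where "hcoeff x y z = Poly_Mapping.lookup (kl_prod x y) z"

definition hdegs :: "'w \<Rightarrow> int set"
  where "hdegs z = {ldeg (hcoeff x y z) | x y. x \<in> carrier G \<and> y \<in> carrier G \<and> hcoeff x y z \<noteq> 0}"

text \<open>On integers, the supremum of a nonempty set bounded above is its maximum.\<close>

definition afun :: "'w \<Rightarrow> int"
  where "afun z = Sup (hdegs z)"

text \<open>
  \<open>\<gamma>\<^sub>x\<^sub>,\<^sub>y\<^sub>,\<^sub>u\<close> with \<open>u = z\<^sup>-\<^sup>1\<close> is the coefficient of \<open>q\<close> to the power \<open>a(z)\<close> in \<open>h\<^sub>x\<^sub>,\<^sub>y\<^sub>,\<^sub>z\<close>.
\<close>

definition gam :: "'w \<Rightarrow> 'w \<Rightarrow> 'w \<Rightarrow> int"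
  where "gam x y u = Poly_Mapping.lookup (hcoeff x y (inv u)) (afun (inv u))"

text \<open>
  The polynomial \<open>P\<^sub>e\<^sub>,\<^sub>w\<close>, where \<open>e\<close> is the identity, is nonzero because all weights \<open>\<phi>(s)\<close> are
  positive.
\<close>

definition delta :: "'w \<Rightarrow> int"
  where "delta w = - ldeg (Poly_Mapping.lookup (C w) \<one>)"

definition ncoeff :: "'w \<Rightarrow> int"
  where "ncoeff w = Poly_Mapping.lookup (Poly_Mapping.lookup (C w) \<one>) (- delta w)"

definition dinv :: "'w set"
  where "dinv = {w \<in> carrier G. afun w = delta w}"

definition le_L :: "('w \<times> 'w) set"
  where "le_L = {(x, y). x \<in> carrier G \<and> y \<in> carrier G \<and> (\<exists>z\<in>carrier G. hcoeff z y x \<noteq> 0)}\<^sup>+"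

definition le_R :: "('w \<times> 'w) set"
  where "le_R = {(x, y). x \<in> carrier G \<and> y \<in> carrier G \<and> (\<exists>z\<in>carrier G. hcoeff y z x \<noteq> 0)}\<^sup>+"

definition le_LR :: "('w \<times> 'w) set"
  where "le_LR = (le_L \<union> le_R)\<^sup>+"

definition sim_L :: "('w \<times> 'w) set"
  where "sim_L = le_L \<inter> le_L\<inverse>"

definition sim_R :: "('w \<times> 'w) set"
  where "sim_R = le_R \<inter> le_R\<inverse>"

definition sim_LR :: "('w \<times> 'w) set"
  where "sim_LR = le_LR \<inter> le_LR\<inverse>"

text \<open>P1 contains the assertion that \<open>a(z)\<close> is finite.\<close>

definition lusztig_P1 :: bool
  where "lusztig_P1 \<longleftrightarrow> (\<forall>z\<in>carrier G. bdd_above (hdegs z) \<and> afun z \<le> delta z)"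

definition lusztig_P2 :: bool
  where "lusztig_P2 \<longleftrightarrow>
    (\<forall>d\<in>dinv. \<forall>x\<in>carrier G. \<forall>y\<in>carrier G. gam x y d \<noteq> 0 \<longrightarrow> y = inv x)"

definition lusztig_P3 :: bool
  where "lusztig_P3 \<longleftrightarrow> (\<forall>x\<in>carrier G. \<exists>!d. d \<in> dinv \<and> gam x (inv x) d \<noteq> 0)"

definition lusztig_P4 :: bool
  where "lusztig_P4 \<longleftrightarrow> (\<forall>z' z. (z', z) \<in> le_LR \<longrightarrow> afun z' \<ge> afun z)"

definition lusztig_P5 :: bool
  where "lusztig_P5 \<longleftrightarrow>
    (\<forall>d\<in>dinv. \<forall>x\<in>carrier G. gam x (inv x) d \<noteq> 0 \<longrightarrow>
       gam x (inv x) d = ncoeff d \<and> (ncoeff d = 1 \<or> ncoeff d = -1))"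

definition lusztig_P6 :: bool
  where "lusztig_P6 \<longleftrightarrow> (\<forall>d\<in>dinv. inv d = d)"

definition lusztig_P7 :: bool
  where "lusztig_P7 \<longleftrightarrow>
    (\<forall>x\<in>carrier G. \<forall>y\<in>carrier G. \<forall>z\<in>carrier G. gam x y z = gam y z x)"

definition lusztig_P8 :: bool
  where "lusztig_P8 \<longleftrightarrow>
    (\<forall>x\<in>carrier G. \<forall>y\<in>carrier G. \<forall>z\<in>carrier G. gam x y z \<noteq> 0 \<longrightarrow>
       (y, inv x) \<in> sim_R \<and> (z, inv y) \<in> sim_R \<and> (x, inv z) \<in> sim_R)"

definition lusztig_P9 :: bool
  where "lusztig_P9 \<longleftrightarrow> (\<forall>z' z. (z', z) \<in> le_L \<and> afun z' = afun z \<longrightarrow> (z', z) \<in> sim_L)"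

definition lusztig_P10 :: bool
  where "lusztig_P10 \<longleftrightarrow> (\<forall>z' z. (z', z) \<in> le_R \<and> afun z' = afun z \<longrightarrow> (z', z) \<in> sim_R)"

definition lusztig_P11 :: bool
  where "lusztig_P11 \<longleftrightarrow> (\<forall>z' z. (z', z) \<in> le_LR \<and> afun z' = afun z \<longrightarrow> (z', z) \<in> sim_LR)"

definition lusztig_P13 :: bool
  where "lusztig_P13 \<longleftrightarrow>
    (\<forall>\<Gamma>\<in>carrier G // sim_R. \<exists>d. \<Gamma> \<inter> dinv = {d} \<and> (\<forall>x\<in>\<Gamma>. gam x (inv x) d \<noteq> 0))"

definition lusztig_P14 :: bool
  where "lusztig_P14 \<longleftrightarrow> (\<forall>z\<in>carrier G. (z, inv z) \<in> sim_LR)"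

text \<open>The sums range over the (finite) support of the summand.\<close>

definition lusztig_P15 :: bool
  where "lusztig_P15 \<longleftrightarrow>
    (\<forall>w\<in>carrier G. \<forall>x\<in>carrier G. \<forall>x'\<in>carrier G. \<forall>y\<in>carrier G. afun w = afun y \<longrightarrow>
       (\<Sum>y'. in_q' (hcoeff w x' y') * in_q (hcoeff x y' y)) =
       (\<Sum>y'. in_q (hcoeff x w y') * in_q' (hcoeff y' x' y)))"

end

text \<open>
  In P12 the Hecke algebra of the parabolic subgroup \<open>W\<^sub>I\<close> and its Kazhdan--Lusztig basis are
  determined by \<open>(W\<^sub>I, I)\<close> and the restricted weight function, so they are simply quantified.
\<close>

definition lusztig_P12 ::
    "('w, 'b) monoid_scheme \<Rightarrow> 'w set \<Rightarrow> ('w \<Rightarrow> nat) \<Rightarrow> ('w \<Rightarrow>\<^sub>0 laurent) ring \<Rightarrow>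
     ('w \<Rightarrow> ('w \<Rightarrow>\<^sub>0 laurent)) \<Rightarrow> bool"
  where "lusztig_P12 G S \<phi> H C \<longleftrightarrow>
    (\<forall>I\<subseteq>S. \<forall>H' C'. let G' = subgroup_generated G I in
       hecke_algebra G' I \<phi> H' \<and> kl_basis G' I H' C' \<longrightarrow>
       (\<forall>y\<in>carrier G'. afun G' H' C' y = afun G H C y))"

definition lusztig_P1_to_P15 ::
    "('w, 'b) monoid_scheme \<Rightarrow> 'w set \<Rightarrow> ('w \<Rightarrow> nat) \<Rightarrow> ('w \<Rightarrow>\<^sub>0 laurent) ring \<Rightarrow>
     ('w \<Rightarrow> ('w \<Rightarrow>\<^sub>0 laurent)) \<Rightarrow> bool"
  where "lusztig_P1_to_P15 G S \<phi> H C \<longleftrightarrow>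
    lusztig_P1 G H C \<and> lusztig_P2 G H C \<and> lusztig_P3 G H C \<and> lusztig_P4 G H C \<and>
    lusztig_P5 G H C \<and> lusztig_P6 G H C \<and> lusztig_P7 G H C \<and> lusztig_P8 G H C \<and>
    lusztig_P9 G H C \<and> lusztig_P10 G H C \<and> lusztig_P11 G H C \<and> lusztig_P12 G S \<phi> H C \<and>
    lusztig_P13 G H C \<and> lusztig_P14 G H C \<and> lusztig_P15 G H C"


section \<open>The asymptotic algebra\<close>

text \<open>
  The underlying module is the library's free abelian group, with \<open>t\<^sub>w\<close> being \<open>frag_of w\<close>.
\<close>

abbreviation asym_carrier :: "('w, 'b) monoid_scheme \<Rightarrow> ('w \<Rightarrow>\<^sub>0 int) set"
  where "asym_carrier G \<equiv> carrier (free_Abelian_group (carrier G))"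

context
  fixes G :: "('w, 'b) monoid_scheme" (structure)
    and H :: "('w \<Rightarrow>\<^sub>0 laurent) ring"
    and C :: "'w \<Rightarrow> ('w \<Rightarrow>\<^sub>0 laurent)"
begin

text \<open>
  The product \<open>t\<^sub>x t\<^sub>y\<close>. The sum is restricted to those \<open>z\<close> with \<open>h\<^sub>x\<^sub>,\<^sub>y\<^sub>,\<^sub>z \<noteq> 0\<close>, a finite set outside
  which the coefficient of \<open>t\<^sub>z\<close> vanishes.
\<close>

definition asym_basis_mult :: "'w \<Rightarrow> 'w \<Rightarrow> ('w \<Rightarrow>\<^sub>0 int)"
  where "asym_basis_mult x y =
    (\<Sum>z\<in>Poly_Mapping.keys (kl_prod G H C x y). frag_cmul (gam G H C x y (inv z)) (frag_of z))"

definition asym_mult :: "('w \<Rightarrow>\<^sub>0 int) \<Rightarrow> ('w \<Rightarrow>\<^sub>0 int) \<Rightarrow> ('w \<Rightarrow>\<^sub>0 int)"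
  where "asym_mult A B = frag_extend (\<lambda>x. frag_extend (\<lambda>y. asym_basis_mult x y) B) A"

definition asym_star :: "('w \<Rightarrow>\<^sub>0 int) \<Rightarrow> ('w \<Rightarrow>\<^sub>0 int)"
  where "asym_star A = frag_extend (\<lambda>w. frag_of (inv w)) A"

definition asym_trace :: "('w \<Rightarrow>\<^sub>0 int) \<Rightarrow> int"
  where "asym_trace A =
    (\<Sum>d\<in>Poly_Mapping.keys A \<inter> dinv G H C. ncoeff G C d * Poly_Mapping.lookup A d)"

definition asym_form :: "('w \<Rightarrow>\<^sub>0 int) \<Rightarrow> ('w \<Rightarrow>\<^sub>0 int) \<Rightarrow> int"
  where "asym_form A B = asym_trace (asym_mult A (asym_star B))"

end


section \<open>Traces and inner products on free abelian groups\<close>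

definition int_linear_on :: "('w \<Rightarrow>\<^sub>0 int) set \<Rightarrow> (('w \<Rightarrow>\<^sub>0 int) \<Rightarrow> int) \<Rightarrow> bool"
  where "int_linear_on M \<tau> \<longleftrightarrow>
    (\<forall>A\<in>M. \<forall>B\<in>M. \<tau> (A + B) = \<tau> A + \<tau> B) \<and> (\<forall>c. \<forall>A\<in>M. \<tau> (frag_cmul c A) = c * \<tau> A)"

definition trace_functional_on ::
    "('w \<Rightarrow>\<^sub>0 int) set \<Rightarrow> (('w \<Rightarrow>\<^sub>0 int) \<Rightarrow> ('w \<Rightarrow>\<^sub>0 int) \<Rightarrow> ('w \<Rightarrow>\<^sub>0 int)) \<Rightarrow>
     (('w \<Rightarrow>\<^sub>0 int) \<Rightarrow> int) \<Rightarrow> bool"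
  where "trace_functional_on M m \<tau> \<longleftrightarrow>
    int_linear_on M \<tau> \<and> (\<forall>A\<in>M. \<forall>B\<in>M. \<tau> (m A B) = \<tau> (m B A))"

definition inner_product_on ::
    "('w \<Rightarrow>\<^sub>0 int) set \<Rightarrow> (('w \<Rightarrow>\<^sub>0 int) \<Rightarrow> ('w \<Rightarrow>\<^sub>0 int) \<Rightarrow> int) \<Rightarrow> bool"
  where "inner_product_on M f \<longleftrightarrow>
    (\<forall>B\<in>M. int_linear_on M (\<lambda>A. f A B)) \<and> (\<forall>A\<in>M. int_linear_on M (f A)) \<and>
    (\<forall>A\<in>M. \<forall>B\<in>M. f A B = f B A) \<and>
    (\<forall>A\<in>M. A \<noteq> 0 \<longrightarrow> f A A > 0)"

definition orthonormal_basis_on ::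
    "('w \<Rightarrow>\<^sub>0 int) set \<Rightarrow> (('w \<Rightarrow>\<^sub>0 int) \<Rightarrow> ('w \<Rightarrow>\<^sub>0 int) \<Rightarrow> int) \<Rightarrow>
     'i set \<Rightarrow> ('i \<Rightarrow> ('w \<Rightarrow>\<^sub>0 int)) \<Rightarrow> bool"
  where "orthonormal_basis_on M f I b \<longleftrightarrow>
    b ` I \<subseteq> M \<and>
    (\<forall>A\<in>M. \<exists>!c. Poly_Mapping.keys c \<subseteq> I \<and> A = frag_extend b c) \<and>
    (\<forall>i\<in>I. \<forall>j\<in>I. f (b i) (b j) = (if i = j then 1 else 0))"

end

theory Submission
  imports Defs
begin

text \<open>
  By P2, P3, P5 and P6 the trace of \<open>t\<^sub>x t\<^sub>y\<close> is 1 if \<open>y = x\<^sup>-\<^sup>1\<close> and 0 otherwise, which gives the trace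
  property and orthonormality. The adjunction formula becomes
  \<open>\<gamma>\<^sub>x\<^sub>,\<^sub>y\<^sub>,\<^sub>z = \<gamma>\<^sub>u\<^sub>,\<^sub>v\<^sub>,\<^sub>w\<close> with \<open>(u, v, w) = (x\<^sup>-\<^sup>1, z\<^sup>-\<^sup>1, y\<^sup>-\<^sup>1)\<close>. Up to the cyclic symmetry P7 this says that
  \<open>\<gamma>\<close> is invariant under the anti-involution \<open>T\<^sub>w \<mapsto> T\<^sub>v\<close>, \<open>v = w\<^sup>-\<^sup>1\<close>, of the Hecke algebra: it commutes
  with the bar involution, so by uniqueness of the Kazhdan--Lusztig basis it maps \<open>C\<^sub>w\<close> to \<open>C\<^sub>v\<close>.
\<close>

section \<open>Linear extension of maps on a basis\<close>

text \<open>With \<open>f\<close> equal to \<open>C\<close> this is literally the expansion in the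
  definition of \<open>kl_prod\<close>, so \<open>lin_ext_def\<close> converts one into the
  other.\<close>

definition lin_ext :: "('v \<Rightarrow> ('w \<Rightarrow>\<^sub>0 laurent)) \<Rightarrow> ('v \<Rightarrow>\<^sub>0 laurent) \<Rightarrow> ('w \<Rightarrow>\<^sub>0 laurent)"
  where "lin_ext f c =
    (\<Sum>z\<in>Poly_Mapping.keys c. hsmult (Poly_Mapping.lookup c z) (f z))"

lemma lookup_hsmult [simp]: "Poly_Mapping.lookup (hsmult a h) w = a * Poly_Mapping.lookup h w"
  by (simp add: hsmult_def Poly_Mapping.map.rep_eq when_def)

lemma keys_hsmult: "Poly_Mapping.keys (hsmult a h) \<subseteq> Poly_Mapping.keys h"
  by (auto simp: in_keys_iff)

lemma hsmult_simps [simp]: "hsmult 0 h = 0" "hsmult a 0 = 0" "hsmult 1 h = h"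
    "hsmult a (hsmult b h) = hsmult (a * b) h"
  by (auto intro!: poly_mapping_eqI simp: mult.assoc)

lemma hsmult_add: "hsmult a (g + h) = hsmult a g + hsmult a h"
  by (intro poly_mapping_eqI) (simp add: lookup_add algebra_simps)

lemma hsmult_add_left: "hsmult (a + b) h = hsmult a h + hsmult b h"
  by (intro poly_mapping_eqI) (simp add: lookup_add distrib_right)

lemma hsmult_diff: "hsmult a (g - h) = hsmult a g - hsmult a h"
  by (intro poly_mapping_eqI) (simp add: lookup_minus algebra_simps)

lemma hsmult_sum: "hsmult a (sum f A) = (\<Sum>x\<in>A. hsmult a (f x))"
  by (induction A rule: infinite_finite_induct) (auto simp: hsmult_add)

lemma lookup_lin_ext: "Poly_Mapping.lookup (lin_ext f c) v =
    (\<Sum>z\<in>Poly_Mapping.keys c. Poly_Mapping.lookup c z * Poly_Mapping.lookup (f z) v)"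
  by (simp add: lin_ext_def lookup_sum)

text \<open>Supports may shrink by cancellation; a common finite superset makes sums over different
  supports comparable.\<close>

lemma lin_ext_superset:
  assumes "finite A" "Poly_Mapping.keys c \<subseteq> A"
  shows "lin_ext f c = (\<Sum>z\<in>A. hsmult (Poly_Mapping.lookup c z) (f z))"
  unfolding lin_ext_def using assms by (intro sum.mono_neutral_left) (auto simp: in_keys_iff)

lemma lin_ext_zero [simp]: "lin_ext f 0 = 0"
  by (simp add: lin_ext_def)

lemma lin_ext_single [simp]: "lin_ext f (Poly_Mapping.single w a) = hsmult a (f w)"
  by (simp add: lin_ext_def)

lemma lin_ext_add: "lin_ext f (c + d) = lin_ext f c + lin_ext f d"
proof -
  let ?A = "Poly_Mapping.keys c \<union> Poly_Mapping.keys d"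
  have "lin_ext f (c + d) = (\<Sum>z\<in>?A. hsmult (Poly_Mapping.lookup (c + d) z) (f z))"
    by (intro lin_ext_superset) (use keys_add[of c d] in auto)
  also have "\<dots> = (\<Sum>z\<in>?A. hsmult (Poly_Mapping.lookup c z) (f z)
      + hsmult (Poly_Mapping.lookup d z) (f z))"
    by (simp add: lookup_add hsmult_add_left)
  also have "\<dots> = lin_ext f c + lin_ext f d"
    by (simp add: sum.distrib lin_ext_superset[of ?A])
  finally show ?thesis .
qed

lemma lin_ext_diff: "lin_ext f (c - d) = lin_ext f c - lin_ext f d"
  by (metis add_diff_cancel_right' diff_add_cancel lin_ext_add)

lemma lin_ext_hsmult: "lin_ext f (hsmult a c) = hsmult a (lin_ext f c)"
  by (subst lin_ext_superset[OF finite_keys keys_hsmult]) (simp add: lin_ext_def hsmult_sum)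

lemma lin_ext_sum: "lin_ext f (sum g A) = (\<Sum>x\<in>A. lin_ext f (g x))"
  by (induction A rule: infinite_finite_induct) (auto simp: lin_ext_add)

lemma lin_ext_cong:
  "(\<And>z. z \<in> Poly_Mapping.keys c \<Longrightarrow> f z = g z) \<Longrightarrow> lin_ext f c = lin_ext g c"
  by (simp add: lin_ext_def)

lemma lin_ext_comp: "lin_ext f (lin_ext g c) = lin_ext (\<lambda>x. lin_ext f (g x)) c"
  by (simp add: lin_ext_def[of g] lin_ext_def[of "\<lambda>x. lin_ext f (g x)"] lin_ext_sum
      lin_ext_hsmult)

lemma lin_ext_T_basis [simp]: "lin_ext T_basis c = c"
proof (rule poly_mapping_eqI)
  fix v
  have "Poly_Mapping.lookup (lin_ext T_basis c) v =
      (\<Sum>z\<in>Poly_Mapping.keys c. if z = v then Poly_Mapping.lookup c v else 0)"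
    unfolding lookup_lin_ext by (intro sum.cong) (auto simp: lookup_single when_def)
  then show "Poly_Mapping.lookup (lin_ext T_basis c) v = Poly_Mapping.lookup c v"
    by (simp add: in_keys_iff)
qed

lemma lin_ext_minus_fun: "lin_ext (\<lambda>z. f z - g z) c = lin_ext f c - lin_ext g c"
  by (simp add: lin_ext_def hsmult_diff sum_subtractf)

lemma keys_lin_ext:
  "Poly_Mapping.keys (lin_ext f c) \<subseteq> (\<Union>z\<in>Poly_Mapping.keys c. Poly_Mapping.keys (f z))"
  unfolding lin_ext_def using keys_hsmult by (intro order_trans[OF keys_sum]) fastforce


section \<open>The length function of a Coxeter system\<close>

locale coxeter = group G for G :: "('w, 'b) monoid_scheme" (structure) +
  fixes S :: "'w set"
  assumes coxeter: "coxeter_system G S"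
begin

abbreviation len :: "'w \<Rightarrow> nat"
  where "len \<equiv> cox_length G S"

lemma S_carrier: "s \<in> S \<Longrightarrow> s \<in> carrier G"
  using coxeter by (auto simp: coxeter_system_def)

lemma S_square: "s \<in> S \<Longrightarrow> s \<otimes> s = \<one>"
  using coxeter pow_ord_eq_1[of s] S_carrier[of s]
  by (auto simp: coxeter_system_def numeral_2_eq_2)

lemma S_inv: "s \<in> S \<Longrightarrow> inv s = s"
  using S_square S_carrier by (simp add: inv_equality)

lemma S_cancel_left: "s \<in> S \<Longrightarrow> w \<in> carrier G \<Longrightarrow> s \<otimes> (s \<otimes> w) = w"
  using S_square S_carrier by (simp flip: m_assoc)

lemma word_prod_simps [simp]: "word_prod G [] = \<one>" "word_prod G (s # ws) = s \<otimes> word_prod G ws"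
  by (simp_all add: word_prod_def)

lemma word_prod_closed [simp]: "ws \<in> lists S \<Longrightarrow> word_prod G ws \<in> carrier G"
  by (induction ws) (auto simp: S_carrier)

lemma word_prod_append:
  "us \<in> lists S \<Longrightarrow> vs \<in> lists S \<Longrightarrow> word_prod G (us @ vs) = word_prod G us \<otimes> word_prod G vs"
  by (induction us) (auto simp: S_carrier m_assoc)

lemma word_prod_rev: "ws \<in> lists S \<Longrightarrow> word_prod G (rev ws) = inv (word_prod G ws)"
  by (induction ws) (auto simp: S_carrier S_inv word_prod_append inv_mult_group in_listsI)

lemma ex_word:
  assumes "w \<in> carrier G"
  obtains ws where "ws \<in> lists S" "word_prod G ws = w"
proof -
  have "w \<in> generate G S"
    using assms coxeter by (simp add: coxeter_system_def)
  then have "\<exists>ws\<in>lists S. word_prod G ws = w"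
  proof induction
    case one
    show ?case by (intro bexI[of _ "[]"]) auto
  next
    case (incl h)
    then show ?case by (intro bexI[of _ "[h]"]) (auto simp: S_carrier)
  next
    case (inv h)
    then show ?case by (intro bexI[of _ "[h]"]) (auto simp: S_carrier S_inv)
  next
    case (eng g h)
    then obtain us vs where "us \<in> lists S" "vs \<in> lists S" "word_prod G us = g" "word_prod G vs = h"
      by blast
    then show ?case by (intro bexI[of _ "us @ vs"]) (auto simp: word_prod_append)
  qed
  then show ?thesis using that by blast
qed

lemma len_word_prod_le: "ws \<in> lists S \<Longrightarrow> len (word_prod G ws) \<le> length ws"
  unfolding cox_length_def by (rule Least_le) blast

lemma ex_reduced_word:
  assumes "w \<in> carrier G"
  obtains ws where "ws \<in> lists S" "word_prod G ws = w" "length ws = len w"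
proof -
  obtain us where "us \<in> lists S" "word_prod G us = w"
    using assms by (rule ex_word)
  then have "\<exists>ws\<in>lists S. length ws = len w \<and> word_prod G ws = w"
    using LeastI[of "\<lambda>n. \<exists>ws\<in>lists S. length ws = n \<and> word_prod G ws = w" "length us"]
    unfolding cox_length_def by fast
  then show ?thesis using that by blast
qed

lemma len_one [simp]: "len \<one> = 0"
  using len_word_prod_le[of "[]"] by simp

lemma len_inv [simp]:
  assumes "w \<in> carrier G"
  shows "len (inv w) = len w"
proof -
  have le: "len (inv u) \<le> len u" if u: "u \<in> carrier G" for u
  proof -
    obtain ws where "ws \<in> lists S" "word_prod G ws = u" "length ws = len u"
      using ex_reduced_word[OF u] .
    then show ?thesis using len_word_prod_le[of "rev ws"] word_prod_rev[of ws]
      by (simp add: in_lists_conv_set)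
  qed
  show ?thesis using le[OF assms] le[of "inv w"] assms by simp
qed

lemma len_S_mult_le:
  assumes "s \<in> S" "w \<in> carrier G"
  shows "len (s \<otimes> w) \<le> Suc (len w)"
proof -
  obtain ws where "ws \<in> lists S" "word_prod G ws = w" "length ws = len w"
    using ex_reduced_word[OF assms(2)] .
  then show ?thesis using len_word_prod_le[of "s # ws"] assms(1) by simp
qed

text \<open>Every relator has \<open>2 * n\<close> letters, with \<open>n = 0\<close> for a pair of
  infinite order, so inserting or deleting it preserves parity. This is the sign character in terms
  of words.\<close>

lemma coxeter_equiv_parity:
  "coxeter_equiv G S us vs \<Longrightarrow> even (length us) \<longleftrightarrow> even (length vs)"
proof (induction rule: coxeter_equiv.induct)
  case (relator us vs s t)
  have "length (concat (replicate n [s, t])) = 2 * n" for n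
    by (induction n) auto
  then show ?case by simp
qed auto

lemma even_length_word:
  assumes "us \<in> lists S"
  shows "even (length us) \<longleftrightarrow> even (len (word_prod G us))"
proof -
  obtain vs where "vs \<in> lists S" "word_prod G vs = word_prod G us"
      "length vs = len (word_prod G us)"
    using ex_reduced_word[OF word_prod_closed[OF assms]] .
  \<comment> \<open>Here the presentation enters: two words with the same product are linked by
    Coxeter relations.\<close>
  moreover from this have "coxeter_equiv G S us vs"
    using coxeter assms unfolding coxeter_system_def by metis
  ultimately show ?thesis
    using coxeter_equiv_parity[of us vs] by simp
qed

text \<open>Left multiplication by a generator changes the length by at most one, and parity
  excludes equality.\<close>

lemma len_S_mult_cases:
  assumes "s \<in> S" "w \<in> carrier G"
  obtains "len (s \<otimes> w) = Suc (len w)" | "len w = Suc (len (s \<otimes> w))"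
proof -
  obtain ws where "ws \<in> lists S" "word_prod G ws = w" "length ws = len w"
    using ex_reduced_word[OF assms(2)] .
  then have "even (len (s \<otimes> w)) \<longleftrightarrow> odd (len w)"
    using even_length_word[of "s # ws"] assms(1) by auto
  then have "len (s \<otimes> w) \<noteq> len w" by auto
  moreover have "len (s \<otimes> w) \<le> Suc (len w)" "len w \<le> Suc (len (s \<otimes> w))"
    using len_S_mult_le[OF assms] len_S_mult_le[of s "s \<otimes> w"] assms S_cancel_left S_carrier by auto
  ultimately show ?thesis using that by linarith
qed

lemma len_S [simp]: "s \<in> S \<Longrightarrow> len s = 1"
  by (rule len_S_mult_cases[of s \<one>]) (auto simp: S_carrier)

text \<open>Induction along a reduced word, removing its first letter.\<close>

lemma length_induct [consumes 1, case_names one mult]: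
  assumes "w \<in> carrier G" "P \<one>"
    and "\<And>s w. s \<in> S \<Longrightarrow> w \<in> carrier G \<Longrightarrow> len (s \<otimes> w) = Suc (len w) \<Longrightarrow> P w \<Longrightarrow> P (s \<otimes> w)"
  shows "P w"
  using assms(1)
proof (induction "len w" arbitrary: w)
  case 0
  obtain ws where "ws \<in> lists S" "word_prod G ws = w" "length ws = len w"
    using ex_reduced_word[OF 0(2)] .
  then show ?case using 0(1) assms(2) by simp
next
  case (Suc n)
  obtain ws where ws: "ws \<in> lists S" "word_prod G ws = w" "length ws = len w"
    using ex_reduced_word[OF Suc.prems] .
  then obtain s vs where [simp]: "ws = s # vs" using Suc.hyps(2) by (cases ws) auto
  let ?v = "word_prod G vs"
  have v: "s \<in> S" "?v \<in> carrier G" "w = s \<otimes> ?v" using ws by auto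
  \<comment> \<open>The upper bound comes from the remaining word, the lower one from
    \<open>len_S_mult_le\<close>; together they show that the remaining word is reduced.\<close>
  have "len ?v \<le> n" using ws Suc.hyps(2) len_word_prod_le[of vs] by auto
  moreover have "Suc n \<le> Suc (len ?v)" using len_S_mult_le[of s ?v] v Suc.hyps(2) by auto
  ultimately have "len ?v = n" by simp
  then show ?case using assms(3)[of s ?v] Suc.hyps v by simp
qed

text \<open>Each link of the chain increases the length, so Bruhat triangularity can be replaced by
  triangularity for the length.\<close>

lemma bruhat_less_carrier_len:
  assumes "bruhat_less G S u v"
  shows "u \<in> carrier G" "len u < len v"
  using assms unfolding bruhat_less_def by (induction rule: tranclp_induct) auto

end


section \<open>The Hecke algebra, its anti-involution and the bar involution\<close>

locale hecke = coxeter G S + H: ring H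
  for G :: "('w, 'b) monoid_scheme" (structure) and S :: "'w set"
    and H :: "('w \<Rightarrow>\<^sub>0 laurent) ring" +
  fixes \<phi> :: "'w \<Rightarrow> nat"
  assumes hecke: "hecke_algebra G S \<phi> H"
begin

section \<open>Module structure and multiplication rules of the Hecke algebra\<close>

abbreviation qdiff :: "'w \<Rightarrow> laurent"
  where "qdiff s \<equiv> qpow (int (\<phi> s)) - qpow (- int (\<phi> s))"

lemma carrier_H: "h \<in> carrier H \<longleftrightarrow> Poly_Mapping.keys h \<subseteq> carrier G"
  using hecke by (simp add: hecke_algebra_def)

lemma H_zero: "\<zero>\<^bsub>H\<^esub> = 0"
  using hecke by (simp add: hecke_algebra_def)

lemma H_add: "g \<in> carrier H \<Longrightarrow> h \<in> carrier H \<Longrightarrow> g \<oplus>\<^bsub>H\<^esub> h = g + h"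
  using hecke by (simp add: hecke_algebra_def)

lemma H_hsmult:
  assumes "g \<in> carrier H" "h \<in> carrier H"
  shows "hsmult a g \<otimes>\<^bsub>H\<^esub> h = hsmult a (g \<otimes>\<^bsub>H\<^esub> h)" "g \<otimes>\<^bsub>H\<^esub> hsmult a h = hsmult a (g \<otimes>\<^bsub>H\<^esub> h)"
  using hecke assms by (auto simp: hecke_algebra_def)

lemma T_mult: "w \<in> carrier G \<Longrightarrow> w' \<in> carrier G \<Longrightarrow> len (w \<otimes> w') = len w + len w' \<Longrightarrow>
    T_basis w \<otimes>\<^bsub>H\<^esub> T_basis w' = T_basis (w \<otimes> w')"
  using hecke by (simp add: hecke_algebra_def)

lemma T_closed [simp]: "T_basis w \<in> carrier H \<longleftrightarrow> w \<in> carrier G"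
  by (simp add: carrier_H)

lemma H_closed [intro]:
  "0 \<in> carrier H"
  "g \<in> carrier H \<Longrightarrow> h \<in> carrier H \<Longrightarrow> g + h \<in> carrier H"
  "g \<in> carrier H \<Longrightarrow> h \<in> carrier H \<Longrightarrow> g - h \<in> carrier H"
  "h \<in> carrier H \<Longrightarrow> hsmult a h \<in> carrier H"
  using keys_add[of g h] keys_diff[of g h] keys_hsmult[of a h] by (auto simp: carrier_H)

lemma lin_ext_closed:
  "(\<And>z. z \<in> Poly_Mapping.keys c \<Longrightarrow> f z \<in> carrier H) \<Longrightarrow> lin_ext f c \<in> carrier H"
  using keys_lin_ext[of f c] by (fastforce simp: carrier_H)

lemma H_mult_add:
  assumes "g \<in> carrier H" "h \<in> carrier H" "k \<in> carrier H"
  shows "(g + h) \<otimes>\<^bsub>H\<^esub> k = g \<otimes>\<^bsub>H\<^esub> k + h \<otimes>\<^bsub>H\<^esub> k" "k \<otimes>\<^bsub>H\<^esub> (g + h) = k \<otimes>\<^bsub>H\<^esub> g + k \<otimes>\<^bsub>H\<^esub> h"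
  using H.l_distr[OF assms] H.r_distr[OF assms] assms by (auto simp: H_add)

lemma H_mult_diff:
  assumes "g \<in> carrier H" "h \<in> carrier H" "k \<in> carrier H"
  shows "(g - h) \<otimes>\<^bsub>H\<^esub> k = g \<otimes>\<^bsub>H\<^esub> k - h \<otimes>\<^bsub>H\<^esub> k" "k \<otimes>\<^bsub>H\<^esub> (g - h) = k \<otimes>\<^bsub>H\<^esub> g - k \<otimes>\<^bsub>H\<^esub> h"
  using H_mult_add[of "g - h" h k] assms H_closed(3)[of g h] by (auto simp: algebra_simps)

lemma lin_ext_mult:
  assumes f: "\<And>z. z \<in> Poly_Mapping.keys c \<Longrightarrow> f z \<in> carrier H" and h: "h \<in> carrier H"
  shows "lin_ext f c \<otimes>\<^bsub>H\<^esub> h = lin_ext (\<lambda>z. f z \<otimes>\<^bsub>H\<^esub> h) c"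
    and "h \<otimes>\<^bsub>H\<^esub> lin_ext f c = lin_ext (\<lambda>z. h \<otimes>\<^bsub>H\<^esub> f z) c"
proof -
  \<comment> \<open>Generalized to arbitrary finite subsets of the support for the induction.
    Membership in the carrier is carried along because distributivity in \<open>H\<close> is
    available only there.\<close>
  have "(\<Sum>z\<in>A. hsmult (a z) (f z)) \<in> carrier H \<and>
      (\<Sum>z\<in>A. hsmult (a z) (f z)) \<otimes>\<^bsub>H\<^esub> h = (\<Sum>z\<in>A. hsmult (a z) (f z \<otimes>\<^bsub>H\<^esub> h)) \<and>
      h \<otimes>\<^bsub>H\<^esub> (\<Sum>z\<in>A. hsmult (a z) (f z)) = (\<Sum>z\<in>A. hsmult (a z) (h \<otimes>\<^bsub>H\<^esub> f z))"
    if "finite A" "A \<subseteq> Poly_Mapping.keys c" for A a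
    using that
  proof (induction A)
    case empty
    then show ?case using h H.l_null H.r_null by (auto simp: H_zero)
  next
    case (insert x A)
    then show ?case using f h by (auto simp: H_mult_add H_hsmult H_closed)
  qed
  then show "lin_ext f c \<otimes>\<^bsub>H\<^esub> h = lin_ext (\<lambda>z. f z \<otimes>\<^bsub>H\<^esub> h) c"
    and "h \<otimes>\<^bsub>H\<^esub> lin_ext f c = lin_ext (\<lambda>z. h \<otimes>\<^bsub>H\<^esub> f z) c"
    by (simp_all add: lin_ext_def)
qed

text \<open>An element is its own coordinate family for \<open>T_basis\<close>, so identities linear
  in the right factor reduce to basis elements.\<close>

lemma mult_expand:
  assumes "g \<in> carrier H" "h \<in> carrier H"
  shows "g \<otimes>\<^bsub>H\<^esub> h = lin_ext (\<lambda>w. g \<otimes>\<^bsub>H\<^esub> T_basis w) h"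
  using lin_ext_mult(2)[of h T_basis g] assms by (auto simp: carrier_H)

text \<open>Length additivity makes \<open>T_basis \<one>\<close> left neutral on every
  \<open>T_basis w\<close>, hence on the expansion of the ring unit.\<close>

lemma T_one: "T_basis \<one> = \<one>\<^bsub>H\<^esub>"
proof -
  have "T_basis \<one> \<otimes>\<^bsub>H\<^esub> \<one>\<^bsub>H\<^esub> = lin_ext (\<lambda>w. T_basis \<one> \<otimes>\<^bsub>H\<^esub> T_basis w) \<one>\<^bsub>H\<^esub>"
    by (intro mult_expand) auto
  also have "\<dots> = lin_ext T_basis \<one>\<^bsub>H\<^esub>"
    using H.one_closed by (intro lin_ext_cong) (auto simp: carrier_H T_mult subset_iff)
  finally show ?thesis by simp
qed

lemma T_S_square:
  assumes "s \<in> S"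
  shows "T_basis s \<otimes>\<^bsub>H\<^esub> T_basis s = \<one>\<^bsub>H\<^esub> + hsmult (qdiff s) (T_basis s)"
  using hecke assms S_carrier[OF assms] by (auto simp: hecke_algebra_def H_add H_closed)

lemma T_S_mult:
  assumes "s \<in> S" "w \<in> carrier G"
  shows "len (s \<otimes> w) = Suc (len w) \<Longrightarrow> T_basis s \<otimes>\<^bsub>H\<^esub> T_basis w = T_basis (s \<otimes> w)"
    and "len w = Suc (len (s \<otimes> w)) \<Longrightarrow>
      T_basis s \<otimes>\<^bsub>H\<^esub> T_basis w = T_basis (s \<otimes> w) + hsmult (qdiff s) (T_basis w)"
proof -
  note s = S_carrier[OF assms(1)]
  show "T_basis s \<otimes>\<^bsub>H\<^esub> T_basis w = T_basis (s \<otimes> w)" if "len (s \<otimes> w) = Suc (len w)"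
    using that assms s by (intro T_mult) auto
  assume "len w = Suc (len (s \<otimes> w))"
  \<comment> \<open>Since \<open>s \<otimes> w\<close> is shorter, \<open>T_w\<close> factors with
    \<open>T_s\<close> on the left, and the quadratic relation applies to the square of
    \<open>T_s\<close>.\<close>
  then have w: "T_basis w = T_basis s \<otimes>\<^bsub>H\<^esub> T_basis (s \<otimes> w)"
    using T_mult[of s "s \<otimes> w"] assms s by (simp add: S_cancel_left)
  have "T_basis s \<otimes>\<^bsub>H\<^esub> T_basis w = (T_basis s \<otimes>\<^bsub>H\<^esub> T_basis s) \<otimes>\<^bsub>H\<^esub> T_basis (s \<otimes> w)"
    using assms s by (simp add: w H.m_assoc)
  also have "\<dots> = T_basis (s \<otimes> w) + hsmult (qdiff s) (T_basis w)"
    using assms s by (simp add: T_S_square H_mult_add H_closed H_hsmult w)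
  finally show "T_basis s \<otimes>\<^bsub>H\<^esub> T_basis w = T_basis (s \<otimes> w) + hsmult (qdiff s) (T_basis w)" .
qed

section \<open>The anti-involution inverting the indices of the basis elements\<close>

definition flip :: "('w \<Rightarrow>\<^sub>0 laurent) \<Rightarrow> ('w \<Rightarrow>\<^sub>0 laurent)"
  where "flip = lin_ext (\<lambda>w. T_basis (inv w))"

lemma flip_T [simp]: "flip (T_basis w) = T_basis (inv w)"
  by (simp add: flip_def)

lemma flip_closed: "h \<in> carrier H \<Longrightarrow> flip h \<in> carrier H"
  unfolding flip_def by (rule lin_ext_closed) (auto simp: carrier_H)

text \<open>Outside the carrier \<open>inv v\<close> is unspecified, whereas the support of
  \<open>flip h\<close> consists of inverses of group elements; hence the value 0 there.\<close>

lemma lookup_flip: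
  assumes "h \<in> carrier H"
  shows "Poly_Mapping.lookup (flip h) v =
    (if v \<in> carrier G then Poly_Mapping.lookup h (inv v) else 0)"
proof -
  have eq: "inv z = v \<longleftrightarrow> v \<in> carrier G \<and> z = inv v" if "z \<in> Poly_Mapping.keys h" for z
    using that assms by (auto simp: carrier_H)
  have "Poly_Mapping.lookup (flip h) v = (\<Sum>z\<in>Poly_Mapping.keys h.
      if z = inv v then (if v \<in> carrier G then Poly_Mapping.lookup h (inv v) else 0) else 0)"
    unfolding flip_def lookup_lin_ext using eq
    by (intro sum.cong) (auto simp: lookup_single when_def)
  then show ?thesis by (simp add: in_keys_iff)
qed

text \<open>The left multiplication rule for \<open>T_s\<close> has a mirror image on the right. If
  the length increases, both sides are basis elements; if it decreases, the quadratic relation is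
  applied on the right.\<close>

lemma flip_T_S_mult_T:
  assumes "s \<in> S" "w \<in> carrier G"
  shows "flip (T_basis s \<otimes>\<^bsub>H\<^esub> T_basis w) = T_basis (inv w) \<otimes>\<^bsub>H\<^esub> T_basis s"
  using assms
proof (cases rule: len_S_mult_cases)
  case 1
  note s = S_carrier[OF assms(1)] S_inv[OF assms(1)]
  have inv: "inv (s \<otimes> w) = inv w \<otimes> s" using assms s by (simp add: inv_mult_group)
  have "len (inv w \<otimes> s) = Suc (len w)" using 1 assms s by (simp flip: inv)
  then show ?thesis using 1 assms s by (simp add: T_S_mult T_mult inv)
next
  case 2
  note s = S_carrier[OF assms(1)] S_inv[OF assms(1)]
  have inv: "inv (s \<otimes> w) = inv w \<otimes> s" using assms s by (simp add: inv_mult_group)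
  \<comment> \<open>Inserting the square of \<open>s\<close> exhibits \<open>inv w\<close> as a
    product with additive lengths ending in \<open>s\<close>.\<close>
  have w: "inv w = inv w \<otimes> s \<otimes> s" using assms s by (simp add: m_assoc S_square)
  have "len (inv w \<otimes> s \<otimes> s) = len (inv w \<otimes> s) + len s"
    using 2 assms s by (simp flip: w) (simp flip: inv)
  then have Tw: "T_basis (inv w) = T_basis (inv w \<otimes> s) \<otimes>\<^bsub>H\<^esub> T_basis s"
    using T_mult[of "inv w \<otimes> s" s] assms s by (simp flip: w)
  have "T_basis (inv w) \<otimes>\<^bsub>H\<^esub> T_basis s =
      T_basis (inv w \<otimes> s) \<otimes>\<^bsub>H\<^esub> (T_basis s \<otimes>\<^bsub>H\<^esub> T_basis s)"
    using assms s by (simp add: Tw H.m_assoc)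
  also have "\<dots> = T_basis (inv w \<otimes> s) + hsmult (qdiff s) (T_basis (inv w))"
    using assms s by (simp add: T_S_square H_mult_add H_closed H_hsmult Tw)
  also have "\<dots> = flip (T_basis s \<otimes>\<^bsub>H\<^esub> T_basis w)"
    using 2 assms s by (simp add: T_S_mult flip_def lin_ext_add lin_ext_hsmult inv)
  finally show ?thesis by simp
qed

lemma flip_T_S_mult:
  assumes "s \<in> S" "h \<in> carrier H"
  shows "flip (T_basis s \<otimes>\<^bsub>H\<^esub> h) = flip h \<otimes>\<^bsub>H\<^esub> T_basis s"
proof -
  note s = S_carrier[OF assms(1)]
  have "flip (T_basis s \<otimes>\<^bsub>H\<^esub> h) = lin_ext (\<lambda>w. flip (T_basis s \<otimes>\<^bsub>H\<^esub> T_basis w)) h"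
    using assms s by (simp add: mult_expand[of "T_basis s" h]) (simp add: flip_def lin_ext_comp)
  also have "\<dots> = lin_ext (\<lambda>w. T_basis (inv w) \<otimes>\<^bsub>H\<^esub> T_basis s) h"
    using assms by (intro lin_ext_cong flip_T_S_mult_T) (auto simp: carrier_H)
  also have "\<dots> = flip h \<otimes>\<^bsub>H\<^esub> T_basis s"
    unfolding flip_def using assms s by (subst lin_ext_mult) (auto simp: carrier_H)
  finally show ?thesis .
qed

text \<open>The generator case propagates along a reduced word: associativity moves
  \<open>T_s\<close> to the outside, and the induction hypothesis handles
  \<open>T_w\<close>.\<close>

lemma flip_T_mult:
  assumes "w \<in> carrier G" "h \<in> carrier H"
  shows "flip (T_basis w \<otimes>\<^bsub>H\<^esub> h) = flip h \<otimes>\<^bsub>H\<^esub> T_basis (inv w)"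
  using assms
proof (induction arbitrary: h rule: length_induct)
  case one
  then show ?case using flip_closed by (simp add: T_one)
next
  case (mult s w)
  note s = S_carrier[OF mult.hyps(1)] S_inv[OF mult.hyps(1)]
  have inv: "T_basis (inv (s \<otimes> w)) = T_basis (inv w) \<otimes>\<^bsub>H\<^esub> T_basis s"
    using flip_T_S_mult_T[of s w] mult.hyps by (simp add: T_S_mult)
  have "flip (T_basis (s \<otimes> w) \<otimes>\<^bsub>H\<^esub> h) = flip (T_basis s \<otimes>\<^bsub>H\<^esub> (T_basis w \<otimes>\<^bsub>H\<^esub> h))"
    using mult s by (simp flip: T_S_mult(1) add: H.m_assoc)
  also have "\<dots> = flip h \<otimes>\<^bsub>H\<^esub> T_basis (inv (s \<otimes> w))"
    using mult s flip_closed by (simp add: flip_T_S_mult mult.IH inv H.m_assoc)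
  finally show ?case .
qed

lemma flip_mult:
  assumes "g \<in> carrier H" "h \<in> carrier H"
  shows "flip (g \<otimes>\<^bsub>H\<^esub> h) = flip h \<otimes>\<^bsub>H\<^esub> flip g"
proof -
  have "g \<otimes>\<^bsub>H\<^esub> h = lin_ext (\<lambda>w. T_basis w \<otimes>\<^bsub>H\<^esub> h) g"
    using lin_ext_mult(1)[of g T_basis h] assms by (auto simp: carrier_H)
  then have "flip (g \<otimes>\<^bsub>H\<^esub> h) = lin_ext (\<lambda>w. flip (T_basis w \<otimes>\<^bsub>H\<^esub> h)) g"
    by (simp add: flip_def lin_ext_comp)
  also have "\<dots> = lin_ext (\<lambda>w. flip h \<otimes>\<^bsub>H\<^esub> T_basis (inv w)) g"
    using assms by (intro lin_ext_cong flip_T_mult) (auto simp: carrier_H)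
  also have "\<dots> = flip h \<otimes>\<^bsub>H\<^esub> flip g"
    unfolding flip_def[THEN fun_cong, of g] using assms flip_closed
    by (subst lin_ext_mult) (auto simp: carrier_H)
  finally show ?thesis .
qed

section \<open>Filtration by length, with a strict bound so that unitriangularity reads
  \<open>f w - T_basis w \<in> low (len w)\<close>\<close>

definition low :: "nat \<Rightarrow> ('w \<Rightarrow>\<^sub>0 laurent) set"
  where "low n = {h. Poly_Mapping.keys h \<subseteq> {w \<in> carrier G. len w < n}}"

lemma low_closed:
  "0 \<in> low n"
  "g \<in> low n \<Longrightarrow> h \<in> low n \<Longrightarrow> g + h \<in> low n"
  "g \<in> low n \<Longrightarrow> h \<in> low n \<Longrightarrow> g - h \<in> low n"
  "h \<in> low n \<Longrightarrow> hsmult a h \<in> low n"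
  using keys_add[of g h] keys_diff[of g h] keys_hsmult[of a h] by (auto simp: low_def)

lemma low_mono: "h \<in> low m \<Longrightarrow> m \<le> n \<Longrightarrow> h \<in> low n"
  by (fastforce simp: low_def)

lemma low_carrier: "h \<in> low n \<Longrightarrow> h \<in> carrier H"
  by (auto simp: low_def carrier_H)

lemma T_low: "w \<in> carrier G \<Longrightarrow> len w < n \<Longrightarrow> T_basis w \<in> low n"
  by (simp add: low_def)

lemma lin_ext_low:
  "(\<And>z. z \<in> Poly_Mapping.keys c \<Longrightarrow> f z \<in> low n) \<Longrightarrow> lin_ext f c \<in> low n"
  using keys_lin_ext[of f c] by (fastforce simp: low_def)

lemma T_S_mult_low:
  assumes "s \<in> S" "h \<in> low n"
  shows "T_basis s \<otimes>\<^bsub>H\<^esub> h \<in> low (Suc n)"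
proof -
  note s = S_carrier[OF assms(1)]
  have "T_basis s \<otimes>\<^bsub>H\<^esub> T_basis w \<in> low (Suc n)" if "w \<in> Poly_Mapping.keys h" for w
  proof -
    have w: "w \<in> carrier G" "len w < n" using that assms by (auto simp: low_def)
    have le: "len (s \<otimes> w) \<le> Suc (len w)" using assms(1) w by (intro len_S_mult_le)
    show ?thesis
      using assms(1) w(1)
    proof (cases rule: len_S_mult_cases)
      case 1
      then show ?thesis using assms(1) w s le by (simp add: T_S_mult T_low)
    next
      case 2
      then show ?thesis using assms(1) w s le by (simp add: T_S_mult T_low low_closed)
    qed
  qed
  then show ?thesis
    using assms s low_carrier by (subst mult_expand) (auto intro: lin_ext_low)
qed

text \<open>For a key \<open>w\<close> of maximal length, the corrections
  \<open>f z - T_basis z\<close> of all keys \<open>z\<close> live in lengths below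
  \<open>len w\<close>, so they cannot alter the coefficient at \<open>w\<close>. It is applied to
  both the bar images of the \<open>T_w\<close> and the \<open>C_w\<close>.\<close>

lemma ex_leading_coefficient:
  assumes "c \<noteq> 0" "Poly_Mapping.keys c \<subseteq> carrier G"
    and f: "\<And>w. w \<in> carrier G \<Longrightarrow> f w - T_basis w \<in> low (len w)"
  obtains w where "w \<in> Poly_Mapping.keys c"
    "Poly_Mapping.lookup (lin_ext f c) w = Poly_Mapping.lookup c w"
proof -
  have "Max (len ` Poly_Mapping.keys c) \<in> len ` Poly_Mapping.keys c"
    using assms(1) by (intro Max_in) auto
  then obtain w where w: "w \<in> Poly_Mapping.keys c"
    and max: "len w = Max (len ` Poly_Mapping.keys c)" by force
  have "lin_ext (\<lambda>z. f z - T_basis z) c \<in> low (len w)"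
  proof (rule lin_ext_low)
    fix z assume z: "z \<in> Poly_Mapping.keys c"
    then have "len z \<le> len w" by (simp add: max)
    then show "f z - T_basis z \<in> low (len w)" using f[of z] z assms(2) low_mono by blast
  qed
  then have "w \<notin> Poly_Mapping.keys (lin_ext f c - c)"
    by (auto simp: lin_ext_minus_fun low_def)
  then show ?thesis using w that by (simp add: in_keys_iff lookup_minus)
qed

section \<open>Inverses of the \<open>T_w\<close> and triangularity of the bar involution\<close>

lemma T_S_inverse:
  assumes "s \<in> S"
  shows "T_basis s \<in> Units H"
    and "inv\<^bsub>H\<^esub> (T_basis s) = T_basis s - hsmult (qdiff s) \<one>\<^bsub>H\<^esub>"
proof -
  let ?u = "T_basis s - hsmult (qdiff s) \<one>\<^bsub>H\<^esub>"
  have s: "T_basis s \<in> carrier H" using S_carrier assms by simp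
  then have u: "?u \<in> carrier H" by (intro H_closed H.one_closed)
  have eq: "T_basis s \<otimes>\<^bsub>H\<^esub> ?u = \<one>\<^bsub>H\<^esub>" "?u \<otimes>\<^bsub>H\<^esub> T_basis s = \<one>\<^bsub>H\<^esub>"
    using s assms by (simp_all add: H_mult_diff H_closed H_hsmult T_S_square)
  then show "T_basis s \<in> Units H" using s u by (auto simp: Units_def)
  show "inv\<^bsub>H\<^esub> (T_basis s) = ?u" using s u eq by (intro H.inv_char)
qed

lemma T_Units: "w \<in> carrier G \<Longrightarrow> T_basis w \<in> Units H"
proof (induction rule: length_induct)
  case one
  then show ?case by (simp add: T_one)
next
  case (mult s w)
  then show ?case using H.Units_m_closed[OF T_S_inverse(1)] by (metis T_S_mult(1))
qed

lemma inv_mult_Units: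
  assumes u: "u \<in> Units H" and v: "v \<in> Units H"
  shows "inv\<^bsub>H\<^esub> (u \<otimes>\<^bsub>H\<^esub> v) = inv\<^bsub>H\<^esub> v \<otimes>\<^bsub>H\<^esub> inv\<^bsub>H\<^esub> u"
proof (rule H.inv_char)
  have "u \<otimes>\<^bsub>H\<^esub> v \<otimes>\<^bsub>H\<^esub> (inv\<^bsub>H\<^esub> v \<otimes>\<^bsub>H\<^esub> inv\<^bsub>H\<^esub> u) = u \<otimes>\<^bsub>H\<^esub> (v \<otimes>\<^bsub>H\<^esub> inv\<^bsub>H\<^esub> v) \<otimes>\<^bsub>H\<^esub> inv\<^bsub>H\<^esub> u"
    using u v by (simp add: H.m_assoc H.Units_closed del: H.Units_r_inv)
  then show "u \<otimes>\<^bsub>H\<^esub> v \<otimes>\<^bsub>H\<^esub> (inv\<^bsub>H\<^esub> v \<otimes>\<^bsub>H\<^esub> inv\<^bsub>H\<^esub> u) = \<one>\<^bsub>H\<^esub>" using u v by (simp add: H.Units_closed)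
  have "inv\<^bsub>H\<^esub> v \<otimes>\<^bsub>H\<^esub> inv\<^bsub>H\<^esub> u \<otimes>\<^bsub>H\<^esub> (u \<otimes>\<^bsub>H\<^esub> v) = inv\<^bsub>H\<^esub> v \<otimes>\<^bsub>H\<^esub> (inv\<^bsub>H\<^esub> u \<otimes>\<^bsub>H\<^esub> u) \<otimes>\<^bsub>H\<^esub> v"
    using u v by (simp add: H.m_assoc H.Units_closed del: H.Units_l_inv)
  then show "inv\<^bsub>H\<^esub> v \<otimes>\<^bsub>H\<^esub> inv\<^bsub>H\<^esub> u \<otimes>\<^bsub>H\<^esub> (u \<otimes>\<^bsub>H\<^esub> v) = \<one>\<^bsub>H\<^esub>" using u v by (simp add: H.Units_closed)
qed (use u v in auto)

abbreviation bar_T :: "'w \<Rightarrow> ('w \<Rightarrow>\<^sub>0 laurent)"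
  where "bar_T w \<equiv> inv\<^bsub>H\<^esub> (T_basis (inv w))"

text \<open>The bar image of \<open>T_(sw)\<close> is the inverse of \<open>T_s\<close> times the
  bar image of \<open>T_w\<close>. Since that inverse is \<open>T_s\<close> minus a scalar,
  multiplying \<open>T_w\<close> plus shorter terms gives \<open>T_(sw)\<close> plus shorter
  terms.\<close>

lemma bar_T_low: "w \<in> carrier G \<Longrightarrow> bar_T w - T_basis w \<in> low (len w)"
proof (induction rule: length_induct)
  case one
  then show ?case by (simp add: T_one low_closed)
next
  case (mult s w)
  note s = S_carrier[OF mult.hyps(1)] S_inv[OF mult.hyps(1)]
  define d where "d = bar_T w - T_basis w"
  have d: "d \<in> low (len w)" "d \<in> carrier H" using mult.IH low_carrier by (auto simp: d_def)
  have bar_w: "bar_T w = T_basis w + d" by (simp add: d_def)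
  have "T_basis (inv (s \<otimes> w)) = T_basis (inv w) \<otimes>\<^bsub>H\<^esub> T_basis s"
    using flip_T_S_mult_T[of s w] mult.hyps by (simp add: T_S_mult)
  then have "bar_T (s \<otimes> w) = inv\<^bsub>H\<^esub> (T_basis s) \<otimes>\<^bsub>H\<^esub> bar_T w"
    using inv_mult_Units T_Units mult.hyps s by simp
  also have "\<dots> = T_basis (s \<otimes> w) + (T_basis s \<otimes>\<^bsub>H\<^esub> d - hsmult (qdiff s) (T_basis w + d))"
    unfolding T_S_inverse(2)[OF mult.hyps(1)] bar_w
    using mult.hyps s d by (simp add: H_mult_diff H_mult_add H_closed H_hsmult T_S_mult hsmult_add)
  finally have "bar_T (s \<otimes> w) - T_basis (s \<otimes> w) =
      T_basis s \<otimes>\<^bsub>H\<^esub> d - hsmult (qdiff s) (T_basis w + d)" by simp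
  also have "\<dots> \<in> low (len (s \<otimes> w))"
    unfolding mult.hyps(3) using mult.hyps d low_mono[OF d(1), of "Suc (len w)"]
    by (intro low_closed T_S_mult_low T_low) auto
  finally show ?case .
qed

lemma flip_inv_Units:
  assumes "u \<in> Units H"
  shows "flip (inv\<^bsub>H\<^esub> u) = inv\<^bsub>H\<^esub> (flip u)"
proof -
  have "flip \<one>\<^bsub>H\<^esub> = \<one>\<^bsub>H\<^esub>" by (simp flip: T_one)
  then show ?thesis
    using assms flip_closed flip_mult[of u "inv\<^bsub>H\<^esub> u"] flip_mult[of "inv\<^bsub>H\<^esub> u" u]
    by (intro H.inv_char[symmetric]) auto
qed

section \<open>Semilinearity of the bar involution and its commutation with
  \<open>flip\<close>\<close>

lemma lookup_lbar: "Poly_Mapping.lookup (lbar p) k = Poly_Mapping.lookup p (- k)"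
  by (simp add: lbar_def map_key.rep_eq)

lemma lbar_diff: "lbar (p - q) = lbar p - lbar q"
  by (intro poly_mapping_eqI) (simp add: lookup_lbar lookup_minus)

lemma lbar_zero [simp]: "lbar 0 = 0"
  by (intro poly_mapping_eqI) (simp add: lookup_lbar)

lemma lookup_map_lbar:
  "Poly_Mapping.lookup (Poly_Mapping.map lbar h) w = lbar (Poly_Mapping.lookup h w)"
  by (simp add: Poly_Mapping.map.rep_eq when_def)

lemma keys_map_lbar: "Poly_Mapping.keys (Poly_Mapping.map lbar h) \<subseteq> Poly_Mapping.keys h"
  by (auto simp: in_keys_iff lookup_map_lbar)

text \<open>Separating the conjugation of coefficients leaves a linear map, to which the
  \<open>lin_ext\<close> lemmas and \<open>ex_leading_coefficient\<close> apply.\<close>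

lemma hecke_bar_eq: "hecke_bar G H h = lin_ext bar_T (Poly_Mapping.map lbar h)"
  by (simp add: lin_ext_superset[OF finite_keys keys_map_lbar] hecke_bar_def lookup_map_lbar)

lemma hecke_bar_diff: "hecke_bar G H (g - h) = hecke_bar G H g - hecke_bar G H h"
proof -
  have "Poly_Mapping.map lbar (g - h) = Poly_Mapping.map lbar g - Poly_Mapping.map lbar h"
    by (intro poly_mapping_eqI) (simp only: lookup_map_lbar lookup_minus lbar_diff)
  then show ?thesis by (simp add: hecke_bar_eq lin_ext_diff)
qed

text \<open>On \<open>T_w\<close> both composites give the inverse of \<open>T_w\<close>, and
  conjugating coefficients does not interact with permuting the basis.\<close>

lemma hecke_bar_flip:
  assumes h: "h \<in> carrier H"
  shows "hecke_bar G H (flip h) = flip (hecke_bar G H h)"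
proof -
  have bh: "Poly_Mapping.map lbar h \<in> carrier H"
    using h keys_map_lbar[of h] by (auto simp: carrier_H)
  have "Poly_Mapping.map lbar (flip h) = flip (Poly_Mapping.map lbar h)"
    by (intro poly_mapping_eqI[where 'b = laurent]) (simp add: lookup_map_lbar lookup_flip h bh)
  then have "hecke_bar G H (flip h) = lin_ext (\<lambda>w. bar_T (inv w)) (Poly_Mapping.map lbar h)"
    by (simp add: hecke_bar_eq flip_def lin_ext_comp)
  also have "\<dots> = lin_ext (\<lambda>w. flip (bar_T w)) (Poly_Mapping.map lbar h)"
    using bh by (intro lin_ext_cong) (auto simp: carrier_H flip_inv_Units T_Units)
  also have "\<dots> = flip (hecke_bar G H h)"
    by (simp add: hecke_bar_eq flip_def lin_ext_comp)
  finally show ?thesis .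
qed

text \<open>
  The leading coefficient of a bar-invariant element is itself bar-invariant, and no nonzero
  element of \<open>q\<^sup>-\<^sup>1\<int>[q\<^sup>-\<^sup>1]\<close> is.
\<close>

lemma bar_invariant_negative_zero:
  assumes h: "h \<in> carrier H" and bar: "hecke_bar G H h = h"
    and neg: "\<And>w. Poly_Mapping.keys (Poly_Mapping.lookup h w) \<subseteq> {..<0}"
  shows "h = 0"
proof (rule ccontr)
  let ?c = "Poly_Mapping.map lbar h"
  assume "h \<noteq> 0"
  then have "?c \<noteq> 0" using bar by (auto simp: hecke_bar_eq)
  moreover have "Poly_Mapping.keys ?c \<subseteq> carrier G"
    using h keys_map_lbar[of h] by (auto simp: carrier_H)
  ultimately obtain w where w: "w \<in> Poly_Mapping.keys ?c"
    "Poly_Mapping.lookup (lin_ext bar_T ?c) w = Poly_Mapping.lookup ?c w"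
    using bar_T_low by (rule ex_leading_coefficient)
  define p where "p = Poly_Mapping.lookup h w"
  have p: "lbar p = p" "p \<noteq> 0"
    using w bar by (auto simp: p_def hecke_bar_eq[symmetric] lookup_map_lbar in_keys_iff)
  then obtain k where k: "k \<in> Poly_Mapping.keys p" using keys_eq_empty by blast
  then have "- k \<in> Poly_Mapping.keys p"
    using p lookup_lbar[of p k] by (simp add: in_keys_iff)
  then have "- k < 0" "k < 0" using k neg[of w] by (auto simp: p_def)
  then show False by simp
qed

end


section \<open>The Kazhdan--Lusztig basis\<close>

locale kazhdan_lusztig = hecke G S H \<phi>
  for G :: "('w, 'b) monoid_scheme" (structure) and S :: "'w set"
    and H :: "('w \<Rightarrow>\<^sub>0 laurent) ring" and \<phi> :: "'w \<Rightarrow> nat" +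
  fixes C :: "'w \<Rightarrow> ('w \<Rightarrow>\<^sub>0 laurent)"
  assumes kl_basis: "kl_basis G S H C"
begin

lemma C_closed: "w \<in> carrier G \<Longrightarrow> C w \<in> carrier H"
  using kl_basis by (simp add: kl_basis_def)

lemma C_bar: "w \<in> carrier G \<Longrightarrow> hecke_bar G H (C w) = C w"
  using kl_basis by (simp add: kl_basis_def)

lemma lookup_C_self: "w \<in> carrier G \<Longrightarrow> Poly_Mapping.lookup (C w) w = 1"
  using kl_basis by (simp add: kl_basis_def)

lemma lookup_C_less:
  assumes "w \<in> carrier G" "v \<noteq> w"
  shows "Poly_Mapping.lookup (C w) v \<noteq> 0 \<Longrightarrow> bruhat_less G S v w"
    and "Poly_Mapping.keys (Poly_Mapping.lookup (C w) v) \<subseteq> {..<0}"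
  using kl_basis assms by (cases "Poly_Mapping.lookup (C w) v = 0"; auto simp: kl_basis_def)+

text \<open>Bruhat-smaller elements are shorter, and the coefficient 1 at \<open>w\<close>
  cancels.\<close>

lemma C_low:
  assumes "w \<in> carrier G"
  shows "C w - T_basis w \<in> low (len w)"
proof -
  have "v \<in> carrier G \<and> len v < len w" if "Poly_Mapping.lookup (C w - T_basis w) v \<noteq> 0" for v
  proof -
    have "v \<noteq> w" using that assms by (auto simp: lookup_minus lookup_C_self)
    then have "bruhat_less G S v w"
      using that assms lookup_C_less by (simp add: lookup_minus lookup_single_not_eq)
    then show ?thesis using bruhat_less_carrier_len by blast
  qed
  then show ?thesis by (auto simp: low_def in_keys_iff)
qed

lemma flip_C:
  assumes w: "w \<in> carrier G"
  shows "flip (C w) = C (inv w)"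
proof -
  let ?h = "C (inv w) - flip (C w)"
  have "?h = 0"
  proof (rule bar_invariant_negative_zero)
    show "?h \<in> carrier H" using w C_closed flip_closed by auto
    show "hecke_bar G H ?h = ?h"
      using w C_closed by (simp add: hecke_bar_diff hecke_bar_flip C_bar)
    fix v
    \<comment> \<open>At \<open>inv w\<close> both coefficients are 1 and cancel; elsewhere both
      have only negative exponents.\<close>
    show "Poly_Mapping.keys (Poly_Mapping.lookup ?h v) \<subseteq> {..<0}"
    proof (cases "v = inv w")
      case True
      then show ?thesis using w by (simp add: lookup_minus lookup_flip C_closed lookup_C_self)
    next
      case False
      moreover from this have "v \<in> carrier G \<Longrightarrow> inv v \<noteq> w" by auto
      ultimately show ?thesis
        using keys_diff[of "Poly_Mapping.lookup (C (inv w)) v" "Poly_Mapping.lookup (flip (C w)) v"]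
          lookup_C_less(2)[of "inv w" v] lookup_C_less(2)[of w "inv v"] w
        by (auto simp: lookup_minus lookup_flip C_closed split: if_splits)
    qed
  qed
  then show ?thesis by simp
qed

section \<open>Linear independence and spanning of the Kazhdan-Lusztig elements\<close>

lemma lin_ext_C_inject:
  assumes "Poly_Mapping.keys c \<subseteq> carrier G" "Poly_Mapping.keys d \<subseteq> carrier G"
    and "lin_ext C c = lin_ext C d"
  shows "c = d"
proof (rule ccontr)
  assume "c \<noteq> d"
  then have "c - d \<noteq> 0" by simp
  moreover have "Poly_Mapping.keys (c - d) \<subseteq> carrier G" using assms keys_diff[of c d] by auto
  ultimately obtain w where "w \<in> Poly_Mapping.keys (c - d)"
    "Poly_Mapping.lookup (lin_ext C (c - d)) w = Poly_Mapping.lookup (c - d) w"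
    using C_low by (rule ex_leading_coefficient)
  then show False using assms(3) by (simp add: lin_ext_diff in_keys_iff)
qed

text \<open>Using the \<open>T\<close>-coordinates of \<open>h\<close> as
  \<open>C\<close>-coordinates leaves an error one filtration step lower. Induction expands the
  error, and the two coordinate families add up.\<close>

lemma low_span_C: "h \<in> low n \<Longrightarrow> \<exists>c. Poly_Mapping.keys c \<subseteq> carrier G \<and> h = lin_ext C c"
proof (induction n arbitrary: h)
  case 0
  then show ?case by (intro exI[of _ 0]) (auto simp: low_def)
next
  case (Suc n)
  have "T_basis w - C w \<in> low n" if "w \<in> Poly_Mapping.keys h" for w
  proof -
    have w: "w \<in> carrier G" "len w \<le> n" using that Suc.prems by (auto simp: low_def)
    have "0 - (C w - T_basis w) \<in> low n"
      using low_mono[OF C_low[OF w(1)] w(2)] by (rule low_closed(3)[OF low_closed(1)])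
    then show ?thesis by (simp only: diff_0 minus_diff_eq)
  qed
  then have "lin_ext (\<lambda>w. T_basis w - C w) h \<in> low n" by (rule lin_ext_low)
  then obtain c where c: "Poly_Mapping.keys c \<subseteq> carrier G" "h - lin_ext C h = lin_ext C c"
    using Suc.IH[of "h - lin_ext C h"] by (auto simp: lin_ext_minus_fun)
  have "h = lin_ext C (c + h)" using c(2) by (simp add: lin_ext_add algebra_simps)
  moreover have "Poly_Mapping.keys (c + h) \<subseteq> carrier G"
    using c(1) Suc.prems keys_add[of c h] by (auto simp: low_def)
  ultimately show ?case by blast
qed

lemma span_C:
  assumes "h \<in> carrier H"
  obtains c where "Poly_Mapping.keys c \<subseteq> carrier G" "h = lin_ext C c"
proof -
  \<comment> \<open>Any number above all lengths in the support works; the sum also covers the empty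
    support.\<close>
  let ?n = "Suc (\<Sum>w\<in>Poly_Mapping.keys h. len w)"
  have "h \<in> low ?n"
    using assms by (auto simp: low_def carrier_H less_Suc_eq_le intro!: member_le_sum)
  then show ?thesis using low_span_C that by blast
qed

section \<open>Structure constants in the Kazhdan-Lusztig basis and their symmetry under
  inversion\<close>

lemma kl_prod_eqI:
  assumes "Poly_Mapping.keys c \<subseteq> carrier G" "C x \<otimes>\<^bsub>H\<^esub> C y = lin_ext C c"
  shows "kl_prod G H C x y = c"
  unfolding kl_prod_def lin_ext_def[symmetric]
  using assms lin_ext_C_inject by (intro the_equality) auto

text \<open>Spanning gives existence and independence gives uniqueness, so the definite description
  in \<open>kl_prod\<close> denotes the actual coordinates.\<close>

lemma kl_prod:
  assumes "x \<in> carrier G" "y \<in> carrier G"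
  shows "Poly_Mapping.keys (kl_prod G H C x y) \<subseteq> carrier G"
    and "C x \<otimes>\<^bsub>H\<^esub> C y = lin_ext C (kl_prod G H C x y)"
proof -
  obtain c where c: "Poly_Mapping.keys c \<subseteq> carrier G" "C x \<otimes>\<^bsub>H\<^esub> C y = lin_ext C c"
    using span_C[of "C x \<otimes>\<^bsub>H\<^esub> C y"] assms C_closed by auto
  then show "Poly_Mapping.keys (kl_prod G H C x y) \<subseteq> carrier G"
    "C x \<otimes>\<^bsub>H\<^esub> C y = lin_ext C (kl_prod G H C x y)"
    using kl_prod_eqI by auto
qed

text \<open>Apply \<open>flip\<close> to the expansion of \<open>C x\<close> times
  \<open>C y\<close>: it reverses the factors and, by \<open>flip_C\<close>, inverts every
  index.\<close>

lemma kl_prod_inv: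
  assumes "x \<in> carrier G" "y \<in> carrier G"
  shows "kl_prod G H C (inv y) (inv x) = flip (kl_prod G H C x y)"
proof (rule kl_prod_eqI)
  let ?k = "kl_prod G H C x y"
  have k: "?k \<in> carrier H" using kl_prod(1)[OF assms] by (simp add: carrier_H)
  show "Poly_Mapping.keys (flip ?k) \<subseteq> carrier G"
    using flip_closed[OF k] by (simp add: carrier_H)
  have "C (inv y) \<otimes>\<^bsub>H\<^esub> C (inv x) = flip (C x \<otimes>\<^bsub>H\<^esub> C y)"
    using assms C_closed by (simp add: flip_mult flip_C)
  also have "\<dots> = lin_ext (\<lambda>z. flip (C z)) ?k"
    unfolding kl_prod(2)[OF assms] by (simp add: flip_def lin_ext_comp)
  also have "\<dots> = lin_ext (\<lambda>z. C (inv z)) ?k"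
    using kl_prod(1)[OF assms] by (intro lin_ext_cong flip_C) auto
  also have "\<dots> = lin_ext C (flip ?k)"
    by (simp add: flip_def lin_ext_comp)
  finally show "C (inv y) \<otimes>\<^bsub>H\<^esub> C (inv x) = lin_ext C (flip ?k)" .
qed

lemma hcoeff_inv:
  assumes "x \<in> carrier G" "y \<in> carrier G" "z \<in> carrier G"
  shows "hcoeff G H C (inv y) (inv x) (inv z) = hcoeff G H C x y z"
  using assms kl_prod(1)[of x y] by (simp add: hcoeff_def kl_prod_inv lookup_flip carrier_H)

text \<open>By \<open>hcoeff_inv\<close>, inversion carries the degrees for \<open>u\<close> into
  those for \<open>inv u\<close>; using this twice makes the two degree sets equal.\<close>

lemma afun_inv:
  assumes "z \<in> carrier G"
  shows "afun G H C (inv z) = afun G H C z"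
proof -
  have sub: "hdegs G H C u \<subseteq> hdegs G H C (inv u)" if u: "u \<in> carrier G" for u
  proof
    fix n assume "n \<in> hdegs G H C u"
    then obtain x y where "x \<in> carrier G" "y \<in> carrier G" "hcoeff G H C x y u \<noteq> 0"
      "n = ldeg (hcoeff G H C x y u)" by (auto simp: hdegs_def)
    then show "n \<in> hdegs G H C (inv u)"
      unfolding hdegs_def mem_Collect_eq using u
      by (intro exI[of _ "inv y"] exI[of _ "inv x"]) (simp add: hcoeff_inv)
  qed
  have "hdegs G H C (inv z) = hdegs G H C z"
    using sub[of z] sub[of "inv z"] assms by auto
  then show ?thesis by (simp add: afun_def)
qed

lemma gam_inv:
  assumes "x \<in> carrier G" "y \<in> carrier G" "z \<in> carrier G"
  shows "gam G H C (inv y) (inv x) (inv z) = gam G H C x y z"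
  using assms hcoeff_inv[of x y "inv z"] afun_inv[of z] by (simp add: gam_def afun_inv)

lemma keys_asym_basis_mult:
  assumes "x \<in> carrier G" "y \<in> carrier G"
  shows "Poly_Mapping.keys (asym_basis_mult G H C x y) \<subseteq> carrier G"
  unfolding asym_basis_mult_def using kl_prod(1)[OF assms]
  by (intro order_trans[OF keys_sum]) auto

lemma lookup_asym_basis_mult:
  assumes "z \<in> carrier G"
  shows "Poly_Mapping.lookup (asym_basis_mult G H C x y) z = gam G H C x y (inv z)"
proof -
  have "Poly_Mapping.lookup (asym_basis_mult G H C x y) z =
      (\<Sum>v\<in>Poly_Mapping.keys (kl_prod G H C x y). if v = z then gam G H C x y (inv z) else 0)"
    unfolding asym_basis_mult_def lookup_sum by (intro sum.cong) auto
  \<comment> \<open>Off the support of \<open>kl_prod\<close> the polynomial vanishes and with it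
    every coefficient, so the restricted sum loses nothing.\<close>
  also have "\<dots> = gam G H C x y (inv z)"
    using assms by (auto simp: gam_def hcoeff_def in_keys_iff)
  finally show ?thesis .
qed

end


section \<open>The asymptotic algebra\<close>

lemma lookup_frag_extend: "Poly_Mapping.lookup (frag_extend f A) v =
    (\<Sum>w\<in>Poly_Mapping.keys A. Poly_Mapping.lookup A w * Poly_Mapping.lookup (f w) v)"
  by (simp add: frag_extend_def lookup_sum)

lemma ex1_frag_expansion:
  assumes "Poly_Mapping.keys A \<subseteq> I"
  shows "\<exists>!c. Poly_Mapping.keys c \<subseteq> I \<and> A = frag_extend frag_of c"
  using assms frag_expansion by (metis (mono_tags, lifting))

locale asymptotic = kazhdan_lusztig G S H \<phi> C
  for G :: "('w, 'b) monoid_scheme" (structure) and S :: "'w set"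
    and H :: "('w \<Rightarrow>\<^sub>0 laurent) ring" and \<phi> :: "'w \<Rightarrow> nat"
    and C :: "'w \<Rightarrow> ('w \<Rightarrow>\<^sub>0 laurent)" +
  assumes P: "lusztig_P2 G H C" "lusztig_P3 G H C" "lusztig_P5 G H C" "lusztig_P6 G H C"
    "lusztig_P7 G H C"
begin

abbreviation "\<gamma> \<equiv> gam G H C"

section \<open>The trace on products\<close>

lemma asym_trace_superset:
  assumes "finite F" "Poly_Mapping.keys A \<subseteq> F"
  shows "asym_trace G H C A = (\<Sum>d\<in>F \<inter> dinv G H C. ncoeff G C d * Poly_Mapping.lookup A d)"
  unfolding asym_trace_def using assms by (intro sum.mono_neutral_left) (auto simp: in_keys_iff)

lemma asym_trace_add: "asym_trace G H C (A + B) = asym_trace G H C A + asym_trace G H C B"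
  using keys_add[of A B]
  by (simp add: asym_trace_superset[of "Poly_Mapping.keys A \<union> Poly_Mapping.keys B"]
      lookup_add distrib_left sum.distrib)

lemma asym_trace_cmul: "asym_trace G H C (frag_cmul c A) = c * asym_trace G H C A"
  using keys_cmul[of c A] by (simp add: asym_trace_superset[of "Poly_Mapping.keys A"]
      sum_distrib_left mult.left_commute)

lemma asym_trace_frag_extend:
  fixes f :: "'v \<Rightarrow> ('w \<Rightarrow>\<^sub>0 int)"
  shows "asym_trace G H C (frag_extend f A) =
    (\<Sum>w\<in>Poly_Mapping.keys A. Poly_Mapping.lookup A w * asym_trace G H C (f w))"
proof -
  have "asym_trace G H C 0 = 0" by (simp add: asym_trace_def)
  then have "asym_trace G H C (\<Sum>w\<in>F. g w) = (\<Sum>w\<in>F. asym_trace G H C (g w))"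
    for F :: "'v set" and g :: "'v \<Rightarrow> ('w \<Rightarrow>\<^sub>0 int)"
    by (induction F rule: infinite_finite_induct) (auto simp: asym_trace_add)
  then show ?thesis by (simp add: frag_extend_def asym_trace_cmul)
qed

lemma asym_trace_basis_mult:
  assumes "x \<in> carrier G" "y \<in> carrier G"
  shows "asym_trace G H C (asym_basis_mult G H C x y) = (if y = inv x then 1 else 0)"
proof -
  let ?K = "Poly_Mapping.keys (asym_basis_mult G H C x y) \<inter> dinv G H C"
  have dinv: "d \<in> carrier G" "inv d = d" if "d \<in> dinv G H C" for d
    using that P(4) by (auto simp: dinv_def lusztig_P6_def)
  \<comment> \<open>The coefficient of \<open>t_d\<close> in the product is
    \<open>\<gamma> x y (inv d)\<close>; P6 removes the inverse.\<close>
  have tr: "asym_trace G H C (asym_basis_mult G H C x y) = (\<Sum>d\<in>?K. ncoeff G C d * \<gamma> x y d)"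
    unfolding asym_trace_def using dinv by (intro sum.cong) (auto simp: lookup_asym_basis_mult)
  show ?thesis
  proof (cases "y = inv x")
    case False
    then have "\<gamma> x y d = 0" if "d \<in> ?K" for d
      using that assms P(1) by (auto simp: lusztig_P2_def)
    then show ?thesis using False by (simp add: tr)
  next
    case True
    \<comment> \<open>P3 leaves exactly one summand.\<close>
    obtain d where d: "d \<in> dinv G H C" "\<gamma> x y d \<noteq> 0"
      and unique: "\<And>d'. d' \<in> dinv G H C \<Longrightarrow> \<gamma> x y d' \<noteq> 0 \<Longrightarrow> d' = d"
      using P(2) assms True unfolding lusztig_P3_def by metis
    have "d \<in> ?K" using d dinv[of d] by (simp add: in_keys_iff lookup_asym_basis_mult)
    \<comment> \<open>By P5 both factors are the same sign, so their product is its square.\<close>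
    moreover have "ncoeff G C d * \<gamma> x y d = 1"
      using P(3) d assms True by (force simp: lusztig_P5_def)
    then have "(\<Sum>d'\<in>?K. ncoeff G C d' * \<gamma> x y d') = (\<Sum>d'\<in>?K. if d' = d then 1 else 0)"
      using unique by (intro sum.cong) auto
    ultimately show ?thesis using True tr by simp
  qed
qed

lemma asym_trace_mult:
  assumes "Poly_Mapping.keys A \<subseteq> carrier G" "Poly_Mapping.keys B \<subseteq> carrier G"
  shows "asym_trace G H C (asym_mult G H C A B) =
    (\<Sum>x\<in>Poly_Mapping.keys A. Poly_Mapping.lookup A x * Poly_Mapping.lookup B (inv x))"
proof -
  have "(\<Sum>y\<in>Poly_Mapping.keys B. Poly_Mapping.lookup B y *
        asym_trace G H C (asym_basis_mult G H C x y)) = Poly_Mapping.lookup B (inv x)"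
    if "x \<in> Poly_Mapping.keys A" for x
  proof -
    have "(\<Sum>y\<in>Poly_Mapping.keys B. Poly_Mapping.lookup B y *
          asym_trace G H C (asym_basis_mult G H C x y)) =
        (\<Sum>y\<in>Poly_Mapping.keys B. if y = inv x then Poly_Mapping.lookup B (inv x) else 0)"
      using that assms by (intro sum.cong) (auto simp: asym_trace_basis_mult subset_iff)
    then show ?thesis by (simp add: in_keys_iff)
  qed
  then show ?thesis by (simp add: asym_mult_def asym_trace_frag_extend)
qed

lemma asym_trace_mult_commute:
  assumes A: "Poly_Mapping.keys A \<subseteq> carrier G" and B: "Poly_Mapping.keys B \<subseteq> carrier G"
  shows "asym_trace G H C (asym_mult G H C A B) = asym_trace G H C (asym_mult G H C B A)"
proof -
  \<comment> \<open>After discarding zero terms, inversion is a bijection between the two index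
    sets.\<close>
  let ?A = "Poly_Mapping.keys A \<inter> {x. inv x \<in> Poly_Mapping.keys B}"
  let ?B = "Poly_Mapping.keys B \<inter> {x. inv x \<in> Poly_Mapping.keys A}"
  have "asym_trace G H C (asym_mult G H C A B) =
      (\<Sum>x\<in>?A. Poly_Mapping.lookup A x * Poly_Mapping.lookup B (inv x))"
    unfolding asym_trace_mult[OF A B] by (intro sum.mono_neutral_right) (auto simp: in_keys_iff)
  also have "\<dots> = (\<Sum>y\<in>?B. Poly_Mapping.lookup B y * Poly_Mapping.lookup A (inv y))"
    using A B by (intro sum.reindex_bij_witness[of _ "m_inv G" "m_inv G"]) auto
  also have "\<dots> = asym_trace G H C (asym_mult G H C B A)"
    unfolding asym_trace_mult[OF B A] by (intro sum.mono_neutral_left) (auto simp: in_keys_iff)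
  finally show ?thesis .
qed

section \<open>The bilinear form in coordinates\<close>

lemma keys_asym_star:
  "Poly_Mapping.keys B \<subseteq> carrier G \<Longrightarrow> Poly_Mapping.keys (asym_star G B) \<subseteq> carrier G"
  unfolding asym_star_def by (rule order_trans[OF keys_frag_extend]) auto

lemma keys_asym_mult:
  assumes "Poly_Mapping.keys A \<subseteq> carrier G" "Poly_Mapping.keys B \<subseteq> carrier G"
  shows "Poly_Mapping.keys (asym_mult G H C A B) \<subseteq> carrier G"
proof -
  have "Poly_Mapping.keys (frag_extend (asym_basis_mult G H C x) B) \<subseteq> carrier G"
    if "x \<in> Poly_Mapping.keys A" for x
    using that assms keys_asym_basis_mult[of x]
    by (intro order_trans[OF keys_frag_extend] UN_least) auto
  then show ?thesis
    unfolding asym_mult_def by (rule order_trans[OF keys_frag_extend UN_least])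
qed

text \<open>The star cancels the inversion in \<open>asym_trace_mult\<close>, leaving the standard
  dot product. Symmetry, positivity and orthonormality are read off from it.\<close>

lemma asym_form_eq:
  assumes A: "Poly_Mapping.keys A \<subseteq> carrier G" and B: "Poly_Mapping.keys B \<subseteq> carrier G"
  shows "asym_form G H C A B =
    (\<Sum>x\<in>Poly_Mapping.keys A. Poly_Mapping.lookup A x * Poly_Mapping.lookup B x)"
proof -
  have "Poly_Mapping.lookup (asym_star G B) (inv x) = Poly_Mapping.lookup B x"
    if x: "x \<in> carrier G" for x
  proof -
    have "Poly_Mapping.lookup (asym_star G B) (inv x) =
        (\<Sum>w\<in>Poly_Mapping.keys B. if w = x then Poly_Mapping.lookup B x else 0)"
      unfolding asym_star_def lookup_frag_extend using x B
      by (intro sum.cong) (auto simp: subset_iff)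
    then show ?thesis by (simp add: in_keys_iff)
  qed
  then show ?thesis
    using A by (auto simp: asym_form_def asym_trace_mult[OF A keys_asym_star[OF B]]
        intro!: sum.cong)
qed

lemma asym_form_commute:
  assumes A: "Poly_Mapping.keys A \<subseteq> carrier G" and B: "Poly_Mapping.keys B \<subseteq> carrier G"
  shows "asym_form G H C A B = asym_form G H C B A"
  unfolding asym_form_eq[OF A B] asym_form_eq[OF B A]
  by (intro sum.mono_neutral_cong) (auto simp: in_keys_iff)

text \<open>The sum in \<open>asym_form_eq\<close> is indexed by the support of the first argument,
  so linearity is direct in the second; symmetry later transfers it to the first.\<close>

lemma int_linear_asym_form:
  assumes "Poly_Mapping.keys A \<subseteq> carrier G"
  shows "int_linear_on (asym_carrier G) (asym_form G H C A)"
  unfolding int_linear_on_def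
proof (intro conjI ballI allI)
  fix B D assume "B \<in> asym_carrier G" "D \<in> asym_carrier G"
  then show "asym_form G H C A (B + D) = asym_form G H C A B + asym_form G H C A D"
    using assms keys_add[of B D]
    by (simp add: asym_form_eq order_trans[OF keys_add] lookup_add distrib_left sum.distrib)
next
  fix c D assume "D \<in> asym_carrier G"
  then show "asym_form G H C A (frag_cmul c D) = c * asym_form G H C A D"
    using assms
    by (simp add: asym_form_eq order_trans[OF keys_cmul] sum_distrib_left mult.left_commute)
qed

lemma asym_form_frag_extend:
  assumes "Poly_Mapping.keys D \<subseteq> carrier G"
    and "\<And>w. w \<in> Poly_Mapping.keys A \<Longrightarrow> Poly_Mapping.keys (f w) \<subseteq> carrier G"
  shows "asym_form G H C D (frag_extend f A) =
    (\<Sum>w\<in>Poly_Mapping.keys A. Poly_Mapping.lookup A w * asym_form G H C D (f w))"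
proof -
  have "Poly_Mapping.keys (frag_extend f A) \<subseteq> carrier G"
    using assms(2) by (intro order_trans[OF keys_frag_extend] UN_least)
  then have "asym_form G H C D (frag_extend f A) =
      (\<Sum>z\<in>Poly_Mapping.keys D. \<Sum>w\<in>Poly_Mapping.keys A.
        Poly_Mapping.lookup A w * (Poly_Mapping.lookup D z * Poly_Mapping.lookup (f w) z))"
    using assms(1)
    by (simp add: asym_form_eq lookup_frag_extend sum_distrib_left mult.left_commute)
  also have "\<dots> = (\<Sum>w\<in>Poly_Mapping.keys A. Poly_Mapping.lookup A w * asym_form G H C D (f w))"
    using assms by (subst sum.swap) (simp add: asym_form_eq sum_distrib_left)
  finally show ?thesis .
qed

text \<open>The map \<open>u\<close> covers both sides of the adjunction: the identity gives the
  product with \<open>A\<close>, inversion the product with its star.\<close>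

lemma asym_form_mult:
  assumes "Poly_Mapping.keys A \<subseteq> carrier G" "Poly_Mapping.keys B \<subseteq> carrier G"
    "Poly_Mapping.keys D \<subseteq> carrier G" and u: "\<And>x. x \<in> carrier G \<Longrightarrow> u x \<in> carrier G"
  shows "asym_form G H C D (frag_extend (\<lambda>x. frag_extend (asym_basis_mult G H C (u x)) B) A) =
    (\<Sum>x\<in>Poly_Mapping.keys A. \<Sum>y\<in>Poly_Mapping.keys B. \<Sum>z\<in>Poly_Mapping.keys D.
      Poly_Mapping.lookup A x * (Poly_Mapping.lookup B y * (Poly_Mapping.lookup D z *
        \<gamma> (u x) y (inv z))))"
proof -
  have bm: "Poly_Mapping.keys (asym_basis_mult G H C (u x) y) \<subseteq> carrier G"
    if "x \<in> Poly_Mapping.keys A" "y \<in> Poly_Mapping.keys B" for x y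
    using that assms by (intro keys_asym_basis_mult) auto
  have fe: "Poly_Mapping.keys (frag_extend (asym_basis_mult G H C (u x)) B) \<subseteq> carrier G"
    if "x \<in> Poly_Mapping.keys A" for x
    using that bm by (intro order_trans[OF keys_frag_extend] UN_least)
  have "asym_form G H C D (asym_basis_mult G H C (u x) y) =
      (\<Sum>z\<in>Poly_Mapping.keys D. Poly_Mapping.lookup D z * \<gamma> (u x) y (inv z))"
    if "x \<in> Poly_Mapping.keys A" "y \<in> Poly_Mapping.keys B" for x y
    unfolding asym_form_eq[OF assms(3) bm[OF that]] using assms(3)
    by (intro sum.cong) (auto simp: lookup_asym_basis_mult)
  then show ?thesis
    using assms(3) bm fe by (simp add: asym_form_frag_extend sum_distrib_left)
qed

text \<open>The anti-involution reverses and inverts the first two indices; one cyclic rotation by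
  P7 puts the three in the required order.\<close>

lemma gam_adjoint:
  assumes "x \<in> carrier G" "y \<in> carrier G" "z \<in> carrier G"
  shows "\<gamma> (inv x) z (inv y) = \<gamma> x y (inv z)"
proof -
  have "\<gamma> x y (inv z) = \<gamma> (inv y) (inv x) z"
    using gam_inv[of x y "inv z"] assms by simp
  also have "\<dots> = \<gamma> (inv x) z (inv y)"
    using P(5) assms by (simp add: lusztig_P7_def)
  finally show ?thesis by simp
qed

lemma asym_form_adjoint:
  assumes A: "Poly_Mapping.keys A \<subseteq> carrier G" and B: "Poly_Mapping.keys B \<subseteq> carrier G"
    and D: "Poly_Mapping.keys D \<subseteq> carrier G"
  shows "asym_form G H C (asym_mult G H C A B) D =
    asym_form G H C B (asym_mult G H C (asym_star G A) D)"
proof -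
  \<comment> \<open>Symmetry moves the product to the second argument, where
    \<open>asym_form_mult\<close> expands it.\<close>
  have "asym_form G H C (asym_mult G H C A B) D = asym_form G H C D (asym_mult G H C A B)"
    using A B D by (intro asym_form_commute keys_asym_mult)
  also have "\<dots> =
      (\<Sum>x\<in>Poly_Mapping.keys A. \<Sum>y\<in>Poly_Mapping.keys B. \<Sum>z\<in>Poly_Mapping.keys D.
        Poly_Mapping.lookup A x * (Poly_Mapping.lookup B y * (Poly_Mapping.lookup D z *
          \<gamma> x y (inv z))))"
    unfolding asym_mult_def by (rule asym_form_mult[OF A B D])
  also have "\<dots> =
      (\<Sum>x\<in>Poly_Mapping.keys A. \<Sum>y\<in>Poly_Mapping.keys B. \<Sum>z\<in>Poly_Mapping.keys D.
        Poly_Mapping.lookup A x * (Poly_Mapping.lookup D z * (Poly_Mapping.lookup B y *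
          \<gamma> (inv x) z (inv y))))"
    using A B D by (intro sum.cong) (auto simp: gam_adjoint subset_iff)
  also have "\<dots> =
      (\<Sum>x\<in>Poly_Mapping.keys A. \<Sum>z\<in>Poly_Mapping.keys D. \<Sum>y\<in>Poly_Mapping.keys B.
        Poly_Mapping.lookup A x * (Poly_Mapping.lookup D z * (Poly_Mapping.lookup B y *
          \<gamma> (inv x) z (inv y))))"
    \<comment> \<open>Exchanging the two inner sums matches the expansion with the roles of
      \<open>B\<close> and \<open>D\<close> interchanged.\<close>
    by (rule sum.cong[OF HOL.refl sum.swap])
  also have "\<dots> = asym_form G H C B
      (frag_extend (\<lambda>x. frag_extend (asym_basis_mult G H C (inv x)) D) A)"
    using A B D by (intro asym_form_mult[symmetric]) auto
  \<comment> \<open>Composing linear extensions turns the star on \<open>A\<close> into inversion of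
    the index inside the product.\<close>
  also have "frag_extend (\<lambda>x. frag_extend (asym_basis_mult G H C (inv x)) D) A =
      asym_mult G H C (asym_star G A) D"
    using frag_extend_compose[of "\<lambda>x. frag_extend (asym_basis_mult G H C x) D" "m_inv G" A]
    by (simp add: asym_mult_def asym_star_def o_def)
  finally show ?thesis .
qed

lemma trace_functional: "trace_functional_on (asym_carrier G) (asym_mult G H C) (asym_trace G H C)"
  unfolding trace_functional_on_def int_linear_on_def
  using asym_trace_mult_commute by (simp add: asym_trace_add asym_trace_cmul)

lemma inner_product: "inner_product_on (asym_carrier G) (asym_form G H C)"
proof -
  have "int_linear_on (asym_carrier G) (\<lambda>A. asym_form G H C A B)" if "B \<in> asym_carrier G" for B
  proof -
    have "asym_form G H C A B = asym_form G H C B A" if "A \<in> asym_carrier G" for A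
      using that \<open>B \<in> asym_carrier G\<close> by (simp add: asym_form_commute)
    moreover have "A + D \<in> asym_carrier G" "frag_cmul c A \<in> asym_carrier G"
      if "A \<in> asym_carrier G" "D \<in> asym_carrier G" for A D c
      using that keys_add[of A D] by auto
    ultimately show ?thesis
      using int_linear_asym_form[of B] that unfolding int_linear_on_def by simp
  qed
  moreover have "asym_form G H C A A > 0" if A: "A \<in> asym_carrier G" "A \<noteq> 0" for A
  proof -
    have "0 < (\<Sum>x\<in>Poly_Mapping.keys A. Poly_Mapping.lookup A x * Poly_Mapping.lookup A x)"
      using A(2) by (intro sum_pos) (auto simp: in_keys_iff zero_less_mult_iff)
    then show ?thesis using A(1) by (simp add: asym_form_eq)
  qed
  ultimately show ?thesis
    unfolding inner_product_on_def using int_linear_asym_form by (simp add: asym_form_commute)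
qed

lemma orthonormal_basis:
  "orthonormal_basis_on (asym_carrier G) (asym_form G H C) (carrier G) frag_of"
  unfolding orthonormal_basis_on_def
  by (auto simp: asym_form_eq intro!: ex1_frag_expansion)

end

theorem theorem5p2:
  fixes G :: "('w, 'b) monoid_scheme" and S :: "'w set" and \<phi> :: "'w \<Rightarrow> nat"
    and H :: "('w \<Rightarrow>\<^sub>0 laurent) ring" and C :: "'w \<Rightarrow> ('w \<Rightarrow>\<^sub>0 laurent)"
  assumes "coxeter_system G S"
    and "weight_function G S \<phi>"
    and "\<forall>s\<in>S. \<phi> s > 0"
    and "hecke_algebra G S \<phi> H"
    and "kl_basis G S H C"
    and "hecke_bounded G H"
    and "lusztig_P1_to_P15 G S \<phi> H C"
  shows "trace_functional_on (asym_carrier G) (asym_mult G H C) (asym_trace G H C) \<and>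
    (inner_product_on (asym_carrier G) (asym_form G H C) \<and>
     orthonormal_basis_on (asym_carrier G) (asym_form G H C) (carrier G) frag_of) \<and>
    (\<forall>A\<in>asym_carrier G. \<forall>B\<in>asym_carrier G. \<forall>D\<in>asym_carrier G.
       asym_form G H C (asym_mult G H C A B) D =
       asym_form G H C B (asym_mult G H C (asym_star G A) D))"
proof -
  interpret group G using assms(1) by (simp add: coxeter_system_def)
  interpret coxeter G S by unfold_locales (rule assms(1))
  interpret H: ring H using assms(4) by (simp add: hecke_algebra_def)
  interpret asymptotic G S H \<phi> C
    using assms(4,5,7) by unfold_locales (auto simp: lusztig_P1_to_P15_def)
  show ?thesis
    using trace_functional inner_product orthonormal_basis asym_form_adjoint by simp
qed

end
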